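(* Let $p \colon \mathcal{E} \to \mathcal{B}$ be a faithful functor and let $\bar{\mathcal{E}}$ be the corresponding $\mathcal{Q}_{\mathcal{B}}$-category, where $\mathcal{Q}_{\mathcal{B}}$ is the free quantaloid on $\mathcal{B}$. The following are equivalent: (i) $p$ is topological; (ii) $p$ admits all final liftings of $p$-sieves; (iii) the functor $Y \colon \mathcal{E} \to \mathcal{P}\mathcal{E}$ over $\mathcal{B}$ (from $p$ to $\mathcal{P}p$) admits a left adjoint over $\mathcal{B}$; (iv) the $\mathcal{Q}_{\mathcal{B}}$-category $\bar{\mathcal{E}}$ is total.
   Context: Size: fix a Grothendieck universe; sets in it are small. All ordinary categories have small hom-sets and a possibly large set of objects. Topological functors. Let $p\colon\mathcal{E}\to\mathcal{B}$ be faithful. A map $k\colon px\to pe$ of $\mathcal{B}$ lifts to a map $x\to e$ if $k=p(f)$ for some $f\colon x\to e$ in $\mathcal{E}$. Given a possibly large set $I$, objects $(x_i\in\mathcal{E})_{i\in I}$ and morphisms $(g_i\colon px_i\to z)_{i\in I}$ of $\mathcal{B}$, a final lifting is an object $\bar z\in\mathcal{E}$ with $p\bar z=z$ such that for every $e \in \mathcal{E}$ and $\theta\in\mathcal{B}(z,pe)$: $\theta$ lifts to a map $\bar z\to e$ if and only if for every $i\in I$ the map $\theta\circ g_i\colon px_i\to pe$ lifts to a map $x_i\to e$. The functor $p$ is topological if it admits all final liftings (for all possibly large $I$ and all such families). $p$-sieves. A $p$-sieve on $z\in\mathcal{B}$ is a subfunctor $\phi\subseteq\mathcal{B}(p-,z)\colon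 \mathcal{E}^{\mathrm{op}}\to\mathbf{Set}$, i.e. subsets $\phi(x)\subseteq\mathcal{B}(px,z)$ for $x\in\mathcal{E}$ such that $f\in\phi(y)$ and $g\in\mathcal{E}(x,y)$ imply $f\circ p(g)\in\phi(x)$. It is identified with the family of maps $(g\colon px\to z)_{x\in\mathcal{E},\,g\in\phi(x)}$, and a final lifting of $\phi$ means a final lifting of this family. The category $\mathcal{P}\mathcal{E}$ has as objects pairs of an object $z\in\mathcal{B}$ and a $p$-sieve $\phi$ on $z$; a morphism from $\phi\subseteq\mathcal{B}(p-,z)$ to $\psi\subseteq\mathcal{B}(p-,w)$ is a map $\theta\colon z\to w$ of $\mathcal{B}$ such that $f\in\phi(x)$ implies $\theta\circ f\in\psi(x)$. The faithful functor $\mathcal{P}p\colon\mathcal{P}\mathcal{E}\to\mathcal{B}$ sends a sieve on $z$ to $z$ and a morphism to its underlying map $\theta$. The functor $Y\colon\mathcal{E}\to\mathcal{P}\mathcal{E}$ sends $e$ to the $p$-sieve $\{p(f) : f \in \mathcal{E}(-,e)\}\subseteq\mathcal{B}(p-,pe)$ and satisfies $\mathcal{P}p\circ Y=p$. A left adjoint over $\mathcal{B}$ is a left adjoint in the strict slice 2-category $\mathbf{CAT}/\mathcal{B}$ (1-cells are functors commuting strictly with the functors to $\mathcal{B}$; 2-cells are natural transformations whose components are sent to identities in $\mathcal{B}$). Quantaloids. A quantaloid $\mathcal{Q}$ is a bicategory whose hom-categories $\mathcal{Q}(A,B)$ are complete (small) lattices and whose composition preserves joins in each variable. For $f\colon A\to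 B$, $[f,-]\colon\mathcal{Q}(A,C)\to\mathcal{Q}(B,C)$ denotes the right adjoint of $(-)\circ f$. A $\mathcal{Q}$-category $\mathcal{C}$ consists of a possibly large set $\mathrm{ob}\,\mathcal{C}$, for each $x\in\mathrm{ob}\,\mathcal{C}$ an extent $|x|\in\mathcal{Q}$, and for all $x,y$ a hom-object $\mathcal{C}(x,y)\in\mathcal{Q}(|x|,|y|)$, with $1_{|x|}\leqslant\mathcal{C}(x,x)$ and $\mathcal{C}(y,z)\circ\mathcal{C}(x,y)\leqslant\mathcal{C}(x,z)$. A $\mathcal{Q}$-functor $F\colon\mathcal{C}\to\mathcal{D}$ is an extent-preserving function on objects with $\mathcal{C}(x,y)\leqslant\mathcal{D}(Fx,Fy)$. There is at most one $\mathcal{Q}$-transformation $F \to G$ of $\mathcal{Q}$-functors $F,G\colon\mathcal{C}\to\mathcal{D}$, existing (written $F\leqslant G$) just when $1_{|x|}\leqslant\mathcal{D}(Fx,Gx)$ for all $x$. These form a locally preordered 2-category $\mathcal{Q}\text{-}\mathbf{CAT}$. Presheaves and totality. A presheaf $\phi$ on $\mathcal{C}$ is an object $|\phi|\in\mathcal{Q}$ with arrows $\phi(x)\colon|x|\to|\phi|$ for $x\in\mathrm{ob}\,\mathcal{C}$ such that $\phi(y)\circ\mathcal{C}(x,y)\leqslant\phi(x)$. The $\mathcal{Q}$-category $\mathcal{P}\mathcal{C}$ has presheaves as objects and homs $\mathcal{P}\mathcal{C}(\phi,\psi)=\bigwedge_{x}[\phi(x),\psi(x)]\colon|\phi|\to|\psi|$.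 The Yoneda embedding $Y\colon\mathcal{C}\to\mathcal{P}\mathcal{C}$ sends $x$ to $\mathcal{C}(-,x)$, with extent $|x|$ and components $\mathcal{C}(y,x)$. $\mathcal{C}$ is total if $Y\colon\mathcal{C}\to\mathcal{P}\mathcal{C}$ has a left adjoint in $\mathcal{Q}\text{-}\mathbf{CAT}$. Free quantaloid. $\mathcal{Q}_{\mathcal{B}}$ has the objects of $\mathcal{B}$; morphisms from $X$ to $Y$ are subsets $U\subseteq\mathcal{B}(X,Y)$ ordered by inclusion; $V\circ U=\{v\circ u\mid v\in V,u\in U\}$; the identity at $X$ is $\{1_X\}$. The $\mathcal{Q}_{\mathcal{B}}$-category $\bar{\mathcal{E}}$ corresponding to $p$ has the objects of $\mathcal{E}$, extents $|x|=px$, and homs $\bar{\mathcal{E}}(x,y)=\{p(f)\mid f\in\mathcal{E}(x,y)\}\subseteq\mathcal{B}(px,py)$. *)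

theory Defs
  imports "HOL-Algebra.Complete_Lattice" "HOL-Library.FuncSet"
begin

text \<open>
  Size conventions: a possibly large set is an arbitrary set of some HOL type. No smallness
  condition is imposed on hom-sets, so what is said below about all categories holds in
  particular for the ones whose hom-sets lie in a fixed Grothendieck universe.
\<close>

section \<open>Categories and functors\<close>

text \<open>
  The hom-sets of a category need not be disjoint; the same element can be a morphism between
  several pairs of objects. This allows the morphisms of a category of sieves, and of a free
  quantaloid, to be taken literally as maps, respectively sets of maps, of the base category.
  Accordingly the action of a functor on a morphism also takes its domain and codomain.
\<close>

record ('o, 'm) cat =
  Ob :: "'o set"
  Hom :: "'o \<Rightarrow> 'o \<Rightarrow> 'm set"
  Idt :: "'o \<Rightarrow> 'm"
  Comp :: "'m \<Rightarrow> 'm \<Rightarrow> 'm" (infixr \<open>\<cdot>\<index>\<close> 70)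

locale category =
  fixes C :: "('o, 'm) cat" (structure)
  assumes idt_in: "x \<in> Ob C \<Longrightarrow> Idt C x \<in> Hom C x x"
    and comp_in: "\<lbrakk>x \<in> Ob C; y \<in> Ob C; z \<in> Ob C; f \<in> Hom C x y; g \<in> Hom C y z\<rbrakk>
      \<Longrightarrow> g \<cdot> f \<in> Hom C x z"
    and comp_idt: "\<lbrakk>x \<in> Ob C; y \<in> Ob C; f \<in> Hom C x y\<rbrakk> \<Longrightarrow> f \<cdot> Idt C x = f"
    and idt_comp: "\<lbrakk>x \<in> Ob C; y \<in> Ob C; f \<in> Hom C x y\<rbrakk> \<Longrightarrow> Idt C y \<cdot> f = f"
    and comp_assoc: "\<lbrakk>w \<in> Ob C; x \<in> Ob C; y \<in> Ob C; z \<in> Ob C;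
      f \<in> Hom C w x; g \<in> Hom C x y; h \<in> Hom C y z\<rbrakk> \<Longrightarrow> (h \<cdot> g) \<cdot> f = h \<cdot> (g \<cdot> f)"

record ('o1, 'm1, 'o2, 'm2) func =
  fob :: "'o1 \<Rightarrow> 'o2"
  far :: "'o1 \<Rightarrow> 'o1 \<Rightarrow> 'm1 \<Rightarrow> 'm2"

locale cat_functor = C: category C + D: category D
  for C :: "('o1, 'm1) cat" and D :: "('o2, 'm2) cat" +
  fixes F :: "('o1, 'm1, 'o2, 'm2) func"
  assumes fob_in: "x \<in> Ob C \<Longrightarrow> fob F x \<in> Ob D"
    and far_in: "\<lbrakk>x \<in> Ob C; y \<in> Ob C; f \<in> Hom C x y\<rbrakk>
      \<Longrightarrow> far F x y f \<in> Hom D (fob F x) (fob F y)"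
    and far_idt: "x \<in> Ob C \<Longrightarrow> far F x x (Idt C x) = Idt D (fob F x)"
    and far_comp: "\<lbrakk>x \<in> Ob C; y \<in> Ob C; z \<in> Ob C; f \<in> Hom C x y; g \<in> Hom C y z\<rbrakk>
      \<Longrightarrow> far F x z (g \<cdot>\<^bsub>C\<^esub> f) = far F y z g \<cdot>\<^bsub>D\<^esub> far F x y f"

definition faithful :: "('o1, 'm1) cat \<Rightarrow> ('o1, 'm1, 'o2, 'm2) func \<Rightarrow> bool" where
  "faithful C F \<longleftrightarrow> (\<forall>x\<in>Ob C. \<forall>y\<in>Ob C. inj_on (far F x y) (Hom C x y))"

definition id_func :: "('o, 'm, 'o, 'm) func" where
  "id_func = \<lparr>fob = (\<lambda>x. x), far = (\<lambda>x y f. f)\<rparr>"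

definition comp_func ::
  "('o2, 'm2, 'o3, 'm3) func \<Rightarrow> ('o1, 'm1, 'o2, 'm2) func \<Rightarrow> ('o1, 'm1, 'o3, 'm3) func" where
  "comp_func G F = \<lparr>fob = (\<lambda>x. fob G (fob F x)),
     far = (\<lambda>x y f. far G (fob F x) (fob F y) (far F x y f))\<rparr>"

definition nat_trans :: "('o1, 'm1) cat \<Rightarrow> ('o2, 'm2) cat \<Rightarrow>
  ('o1, 'm1, 'o2, 'm2) func \<Rightarrow> ('o1, 'm1, 'o2, 'm2) func \<Rightarrow> ('o1 \<Rightarrow> 'm2) \<Rightarrow> bool" where
  "nat_trans C D F G \<tau> \<longleftrightarrow>
     (\<forall>x\<in>Ob C. \<tau> x \<in> Hom D (fob F x) (fob G x)) \<and>
     (\<forall>x\<in>Ob C. \<forall>y\<in>Ob C. \<forall>f\<in>Hom C x y. \<tau> y \<cdot>\<^bsub>D\<^esub> far F x y f = far G x y f \<cdot>\<^bsub>D\<^esub> \<tau> x)"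


section \<open>Adjunctions in the strict slice over a category\<close>

text \<open>A 1-cell from \<open>p: C \<rightarrow> B\<close> to \<open>q: D \<rightarrow> B\<close>.\<close>

definition functor_over :: "('ob, 'mb) cat \<Rightarrow> ('o1, 'm1) cat \<Rightarrow> ('o1, 'm1, 'ob, 'mb) func \<Rightarrow>
  ('o2, 'm2) cat \<Rightarrow> ('o2, 'm2, 'ob, 'mb) func \<Rightarrow> ('o1, 'm1, 'o2, 'm2) func \<Rightarrow> bool" where
  "functor_over B C p D q F \<longleftrightarrow>
     cat_functor C B p \<and> cat_functor D B q \<and> cat_functor C D F \<and>
     (\<forall>x\<in>Ob C. fob q (fob F x) = fob p x) \<and>
     (\<forall>x\<in>Ob C. \<forall>y\<in>Ob C. \<forall>f\<in>Hom C x y.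
        far q (fob F x) (fob F y) (far F x y f) = far p x y f)"

text \<open>A 2-cell between 1-cells from \<open>C\<close> to \<open>q: D \<rightarrow> B\<close>.\<close>

definition nat_trans_over :: "('ob, 'mb) cat \<Rightarrow> ('o1, 'm1) cat \<Rightarrow> ('o2, 'm2) cat \<Rightarrow>
  ('o2, 'm2, 'ob, 'mb) func \<Rightarrow> ('o1, 'm1, 'o2, 'm2) func \<Rightarrow> ('o1, 'm1, 'o2, 'm2) func \<Rightarrow>
  ('o1 \<Rightarrow> 'm2) \<Rightarrow> bool" where
  "nat_trans_over B C D q F G \<tau> \<longleftrightarrow> nat_trans C D F G \<tau> \<and>
     (\<forall>x\<in>Ob C. far q (fob F x) (fob G x) (\<tau> x) = Idt B (fob q (fob F x)))"

text \<open>\<open>F: D \<rightarrow> C\<close> is left adjoint to \<open>G: C \<rightarrow> D\<close> with unit \<open>\<eta>\<close> and counit \<open>\<epsilon>\<close>.\<close>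

definition adjunction_over :: "('ob, 'mb) cat \<Rightarrow> ('o1, 'm1) cat \<Rightarrow> ('o1, 'm1, 'ob, 'mb) func \<Rightarrow>
  ('o2, 'm2) cat \<Rightarrow> ('o2, 'm2, 'ob, 'mb) func \<Rightarrow> ('o2, 'm2, 'o1, 'm1) func \<Rightarrow>
  ('o1, 'm1, 'o2, 'm2) func \<Rightarrow> ('o2 \<Rightarrow> 'm2) \<Rightarrow> ('o1 \<Rightarrow> 'm1) \<Rightarrow> bool" where
  "adjunction_over B C p D q F G \<eta> \<epsilon> \<longleftrightarrow>
     functor_over B D q C p F \<and> functor_over B C p D q G \<and>
     nat_trans_over B D D q id_func (comp_func G F) \<eta> \<and>
     nat_trans_over B C C p (comp_func F G) id_func \<epsilon> \<and>
     (\<forall>d\<in>Ob D. \<epsilon> (fob F d) \<cdot>\<^bsub>C\<^esub> far F d (fob G (fob F d)) (\<eta> d) = Idt C (fob F d)) \<and>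
     (\<forall>c\<in>Ob C. far G (fob F (fob G c)) c (\<epsilon> c) \<cdot>\<^bsub>D\<^esub> \<eta> (fob G c) = Idt D (fob G c))"

definition has_left_adjoint_over :: "('ob, 'mb) cat \<Rightarrow> ('o1, 'm1) cat \<Rightarrow>
  ('o1, 'm1, 'ob, 'mb) func \<Rightarrow> ('o2, 'm2) cat \<Rightarrow> ('o2, 'm2, 'ob, 'mb) func \<Rightarrow>
  ('o1, 'm1, 'o2, 'm2) func \<Rightarrow> bool" where
  "has_left_adjoint_over B C p D q G \<longleftrightarrow> (\<exists>F \<eta> \<epsilon>. adjunction_over B C p D q F G \<eta> \<epsilon>)"


section \<open>Topological functors\<close>

definition lifts :: "('oe, 'me) cat \<Rightarrow> ('oe, 'me, 'ob, 'mb) func \<Rightarrow> 'mb \<Rightarrow> 'oe \<Rightarrow> 'oe \<Rightarrow> bool" where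
  "lifts E p k x e \<longleftrightarrow> (\<exists>f\<in>Hom E x e. k = far p x e f)"

definition final_lifting :: "('oe, 'me) cat \<Rightarrow> ('ob, 'mb) cat \<Rightarrow> ('oe, 'me, 'ob, 'mb) func \<Rightarrow>
  'ob \<Rightarrow> 'i set \<Rightarrow> ('i \<Rightarrow> 'oe) \<Rightarrow> ('i \<Rightarrow> 'mb) \<Rightarrow> 'oe \<Rightarrow> bool" where
  "final_lifting E B p z I x g z' \<longleftrightarrow> z' \<in> Ob E \<and> fob p z' = z \<and>
     (\<forall>e\<in>Ob E. \<forall>\<theta>\<in>Hom B z (fob p e).
        lifts E p \<theta> z' e \<longleftrightarrow> (\<forall>i\<in>I. lifts E p (\<theta> \<cdot>\<^bsub>B\<^esub> g i) (x i) e))"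

text \<open>
  HOL cannot quantify over index types inside a definition. The index sets range over the subsets
  of \<open>'oe \<times> 'mb\<close>, which suffices because a family \<open>(x\<^sub>i, g\<^sub>i)\<close> has the same final liftings
  as the set of its members indexed by itself; see \<open>topological_final_lifting\<close> below.
\<close>

definition topological ::
  "('oe, 'me) cat \<Rightarrow> ('ob, 'mb) cat \<Rightarrow> ('oe, 'me, 'ob, 'mb) func \<Rightarrow> bool" where
  "topological E B p \<longleftrightarrow>
     (\<forall>z\<in>Ob B. \<forall>(I :: ('oe \<times> 'mb) set) x g.
        (\<forall>i\<in>I. x i \<in> Ob E \<and> g i \<in> Hom B (fob p (x i)) z) \<longrightarrow>
        (\<exists>z'. final_lifting E B p z I x g z'))"

lemma topological_final_lifting:
  fixes I :: "'i set"
  assumes "topological E B p" and "z \<in> Ob B"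
    and "\<And>i. i \<in> I \<Longrightarrow> x i \<in> Ob E \<and> g i \<in> Hom B (fob p (x i)) z"
  shows "\<exists>z'. final_lifting E B p z I x g z'"
proof -
  have "\<forall>j \<in> (\<lambda>i. (x i, g i)) ` I. fst j \<in> Ob E \<and> snd j \<in> Hom B (fob p (fst j)) z"
    using assms(3) by auto
  then have "\<exists>z'. final_lifting E B p z ((\<lambda>i. (x i, g i)) ` I) fst snd z'"
    using assms(1,2) unfolding topological_def by blast
  then show ?thesis
    by (simp add: final_lifting_def)
qed


section \<open>Sieves\<close>

text \<open>A sieve is empty off the objects of \<open>E\<close>, so that it is determined by its values there.\<close>

definition p_sieve :: "('oe, 'me) cat \<Rightarrow> ('ob, 'mb) cat \<Rightarrow> ('oe, 'me, 'ob, 'mb) func \<Rightarrow>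
  'ob \<Rightarrow> ('oe \<Rightarrow> 'mb set) \<Rightarrow> bool" where
  "p_sieve E B p z \<phi> \<longleftrightarrow>
     (\<forall>x\<in>Ob E. \<phi> x \<subseteq> Hom B (fob p x) z) \<and> (\<forall>x. x \<notin> Ob E \<longrightarrow> \<phi> x = {}) \<and>
     (\<forall>x\<in>Ob E. \<forall>y\<in>Ob E. \<forall>f\<in>\<phi> y. \<forall>g\<in>Hom E x y. f \<cdot>\<^bsub>B\<^esub> far p x y g \<in> \<phi> x)"

definition admits_sieve_liftings ::
  "('oe, 'me) cat \<Rightarrow> ('ob, 'mb) cat \<Rightarrow> ('oe, 'me, 'ob, 'mb) func \<Rightarrow> bool" where
  "admits_sieve_liftings E B p \<longleftrightarrow>
     (\<forall>z\<in>Ob B. \<forall>\<phi>. p_sieve E B p z \<phi> \<longrightarrow>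
        (\<exists>z'. final_lifting E B p z (SIGMA x:Ob E. \<phi> x) fst snd z'))"

definition sieve_cat :: "('oe, 'me) cat \<Rightarrow> ('ob, 'mb) cat \<Rightarrow> ('oe, 'me, 'ob, 'mb) func \<Rightarrow>
  ('ob \<times> ('oe \<Rightarrow> 'mb set), 'mb) cat" where
  "sieve_cat E B p = \<lparr>
     Ob = {(z, \<phi>). z \<in> Ob B \<and> p_sieve E B p z \<phi>},
     Hom = (\<lambda>(z, \<phi>) (w, \<psi>). {\<theta> \<in> Hom B z w. \<forall>x\<in>Ob E. \<forall>f\<in>\<phi> x. \<theta> \<cdot>\<^bsub>B\<^esub> f \<in> \<psi> x}),
     Idt = (\<lambda>(z, \<phi>). Idt B z),
     Comp = Comp B\<rparr>"

definition sieve_proj :: "('ob \<times> ('oe \<Rightarrow> 'mb set), 'mb, 'ob, 'mb) func" where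
  "sieve_proj = \<lparr>fob = fst, far = (\<lambda>_ _ \<theta>. \<theta>)\<rparr>"

definition sieve_yoneda :: "('oe, 'me) cat \<Rightarrow> ('oe, 'me, 'ob, 'mb) func \<Rightarrow>
  ('oe, 'me, 'ob \<times> ('oe \<Rightarrow> 'mb set), 'mb) func" where
  "sieve_yoneda E p = \<lparr>
     fob = (\<lambda>e. (fob p e, \<lambda>x. if x \<in> Ob E then far p x e ` Hom E x e else {})),
     far = far p\<rparr>"


lemma category_sieve_cat:
  assumes "category E" and "category B" and "cat_functor E B p"
  shows "category (sieve_cat E B p)"
proof -
  interpret B: category B by fact
  interpret p: cat_functor E B p by fact
  show ?thesis
  proof (unfold_locales, goal_cases)
    case (1 x)
    obtain z \<phi> where x: "x = (z, \<phi>)" by (cases x)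
    then have z: "z \<in> Ob B" and \<phi>: "p_sieve E B p z \<phi>"
      using 1 by (auto simp: sieve_cat_def)
    have "Idt B z \<cdot>\<^bsub>B\<^esub> f = f" if "a \<in> Ob E" "f \<in> \<phi> a" for a f
      using B.idt_comp[OF p.fob_in z] \<phi> that by (auto simp: p_sieve_def)
    then show ?case
      using z by (simp add: x sieve_cat_def B.idt_in)
  next
    case (2 x y z f g)
    obtain u \<phi> v \<psi> w \<chi> where xyz: "x = (u, \<phi>)" "y = (v, \<psi>)" "z = (w, \<chi>)"
      by (cases x, cases y, cases z)
    then have ob: "u \<in> Ob B" "v \<in> Ob B" "w \<in> Ob B" and \<phi>: "p_sieve E B p u \<phi>"
      and f: "f \<in> Hom B u v" "\<And>a h. \<lbrakk>a \<in> Ob E; h \<in> \<phi> a\<rbrakk> \<Longrightarrow> f \<cdot>\<^bsub>B\<^esub> h \<in> \<psi> a"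
      and g: "g \<in> Hom B v w" "\<And>a h. \<lbrakk>a \<in> Ob E; h \<in> \<psi> a\<rbrakk> \<Longrightarrow> g \<cdot>\<^bsub>B\<^esub> h \<in> \<chi> a"
      using 2 by (auto simp: sieve_cat_def)
    have "(g \<cdot>\<^bsub>B\<^esub> f) \<cdot>\<^bsub>B\<^esub> h = g \<cdot>\<^bsub>B\<^esub> (f \<cdot>\<^bsub>B\<^esub> h)" if "a \<in> Ob E" "h \<in> \<phi> a" for a h
      using B.comp_assoc[OF p.fob_in ob _ f(1) g(1)] \<phi> that by (auto simp: p_sieve_def)
    then show ?case
      using f g B.comp_in[OF ob f(1) g(1)] by (simp add: xyz sieve_cat_def)
  next
    case (3 x y f)
    then show ?case by (auto simp: sieve_cat_def B.comp_idt)
  next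
    case (4 x y f)
    then show ?case by (auto simp: sieve_cat_def B.idt_comp)
  next
    case (5 w x y z f g h)
    then show ?case by (auto simp: sieve_cat_def intro: B.comp_assoc)
  qed
qed

lemma faithful_sieve_proj: "faithful (sieve_cat E B p) sieve_proj"
  by (simp add: faithful_def sieve_proj_def)

lemma functor_over_sieve_yoneda:
  assumes "category E" and "category B" and "cat_functor E B p"
  shows "functor_over B E p (sieve_cat E B p) sieve_proj (sieve_yoneda E p)"
proof -
  interpret B: category B by fact
  interpret p: cat_functor E B p by fact
  interpret S: category "sieve_cat E B p"
    using assms by (rule category_sieve_cat)
  have yob: "fob (sieve_yoneda E p) e \<in> Ob (sieve_cat E B p)" if "e \<in> Ob E" for e
    using that
    by (auto simp: sieve_yoneda_def sieve_cat_def p_sieve_def p.fob_in p.far_in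
        p.C.comp_in simp flip: p.far_comp)
  have yar: "far (sieve_yoneda E p) x y f \<in>
      Hom (sieve_cat E B p) (fob (sieve_yoneda E p) x) (fob (sieve_yoneda E p) y)"
    if "x \<in> Ob E" "y \<in> Ob E" "f \<in> Hom E x y" for x y f
    using that
    by (auto simp: sieve_yoneda_def sieve_cat_def p.far_in p.C.comp_in simp flip: p.far_comp)
  have "cat_functor (sieve_cat E B p) B sieve_proj"
    by unfold_locales (auto simp: sieve_cat_def sieve_proj_def)
  moreover have "cat_functor E (sieve_cat E B p) (sieve_yoneda E p)"
    using yob yar
    by unfold_locales
      (auto simp: sieve_cat_def sieve_yoneda_def p.far_idt p.far_comp)
  ultimately show ?thesis
    using assms by (auto simp: functor_over_def sieve_proj_def sieve_yoneda_def)
qed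


section \<open>Quantaloids and categories enriched in them\<close>

text \<open>
  Since its hom-categories are posets, a quantaloid is strictly associative and unital.
\<close>

record ('q, 'a) quant =
  QOb :: "'q set"
  QHom :: "'q \<Rightarrow> 'q \<Rightarrow> 'a gorder"
  QIdt :: "'q \<Rightarrow> 'a"
  QComp :: "'a \<Rightarrow> 'a \<Rightarrow> 'a" (infixr \<open>\<bullet>\<index>\<close> 70)

definition quant_cat :: "('q, 'a) quant \<Rightarrow> ('q, 'a) cat" where
  "quant_cat Q = \<lparr>Ob = QOb Q, Hom = (\<lambda>A B. carrier (QHom Q A B)), Idt = QIdt Q, Comp = QComp Q\<rparr>"

locale quantaloid =
  fixes Q :: "('q, 'a) quant" (structure)
  assumes category: "category (quant_cat Q)"
    and complete: "\<lbrakk>A \<in> QOb Q; B \<in> QOb Q\<rbrakk> \<Longrightarrow> complete_lattice (QHom Q A B)"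
    and comp_Sup: "\<lbrakk>A \<in> QOb Q; B \<in> QOb Q; C \<in> QOb Q; g \<in> carrier (QHom Q B C);
      S \<subseteq> carrier (QHom Q A B)\<rbrakk>
      \<Longrightarrow> g \<bullet> (\<Squnion>\<^bsub>QHom Q A B\<^esub> S) = \<Squnion>\<^bsub>QHom Q A C\<^esub> ((\<lambda>f. g \<bullet> f) ` S)"
    and Sup_comp: "\<lbrakk>A \<in> QOb Q; B \<in> QOb Q; C \<in> QOb Q; f \<in> carrier (QHom Q A B);
      S \<subseteq> carrier (QHom Q B C)\<rbrakk>
      \<Longrightarrow> (\<Squnion>\<^bsub>QHom Q B C\<^esub> S) \<bullet> f = \<Squnion>\<^bsub>QHom Q A C\<^esub> ((\<lambda>g. g \<bullet> f) ` S)"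

text \<open>
  The value at \<open>h: A \<rightarrow> C\<close> of the right adjoint \<open>[f, -]\<close> of precomposition with \<open>f: A \<rightarrow> B\<close>.
\<close>

definition q_res :: "('q, 'a) quant \<Rightarrow> 'q \<Rightarrow> 'q \<Rightarrow> 'q \<Rightarrow> 'a \<Rightarrow> 'a \<Rightarrow> 'a" where
  "q_res Q A B C f h = (THE r. r \<in> carrier (QHom Q B C) \<and>
     (\<forall>g\<in>carrier (QHom Q B C). g \<bullet>\<^bsub>Q\<^esub> f \<sqsubseteq>\<^bsub>QHom Q A C\<^esub> h \<longleftrightarrow> g \<sqsubseteq>\<^bsub>QHom Q B C\<^esub> r))"

record ('c, 'q, 'a) qcat =
  EOb :: "'c set"
  ext :: "'c \<Rightarrow> 'q"
  EHom :: "'c \<Rightarrow> 'c \<Rightarrow> 'a"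

locale qcategory = quantaloid Q for Q :: "('q, 'a) quant" (structure) +
  fixes C :: "('c, 'q, 'a) qcat"
  assumes ext_in: "x \<in> EOb C \<Longrightarrow> ext C x \<in> QOb Q"
    and ehom_in: "\<lbrakk>x \<in> EOb C; y \<in> EOb C\<rbrakk> \<Longrightarrow> EHom C x y \<in> carrier (QHom Q (ext C x) (ext C y))"
    and unit_le: "x \<in> EOb C \<Longrightarrow> QIdt Q (ext C x) \<sqsubseteq>\<^bsub>QHom Q (ext C x) (ext C x)\<^esub> EHom C x x"
    and comp_le: "\<lbrakk>x \<in> EOb C; y \<in> EOb C; z \<in> EOb C\<rbrakk>
      \<Longrightarrow> EHom C y z \<bullet> EHom C x y \<sqsubseteq>\<^bsub>QHom Q (ext C x) (ext C z)\<^esub> EHom C x z"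

definition qfunctor :: "('q, 'a) quant \<Rightarrow> ('c, 'q, 'a) qcat \<Rightarrow> ('d, 'q, 'a) qcat \<Rightarrow>
  ('c \<Rightarrow> 'd) \<Rightarrow> bool" where
  "qfunctor Q C D F \<longleftrightarrow>
     (\<forall>x\<in>EOb C. F x \<in> EOb D \<and> ext D (F x) = ext C x) \<and>
     (\<forall>x\<in>EOb C. \<forall>y\<in>EOb C. EHom C x y \<sqsubseteq>\<^bsub>QHom Q (ext C x) (ext C y)\<^esub> EHom D (F x) (F y))"

definition qtrans :: "('q, 'a) quant \<Rightarrow> ('c, 'q, 'a) qcat \<Rightarrow> ('d, 'q, 'a) qcat \<Rightarrow>
  ('c \<Rightarrow> 'd) \<Rightarrow> ('c \<Rightarrow> 'd) \<Rightarrow> bool" where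
  "qtrans Q C D F G \<longleftrightarrow>
     (\<forall>x\<in>EOb C. QIdt Q (ext C x) \<sqsubseteq>\<^bsub>QHom Q (ext C x) (ext C x)\<^esub> EHom D (F x) (G x))"

text \<open>
  An adjunction \<open>F \<stileturn> G\<close> in the locally preordered 2-category of \<open>Q\<close>-categories: a unit and a
  counit, the triangle identities being automatic.
\<close>

definition has_left_qadjoint :: "('q, 'a) quant \<Rightarrow> ('c, 'q, 'a) qcat \<Rightarrow> ('d, 'q, 'a) qcat \<Rightarrow>
  ('c \<Rightarrow> 'd) \<Rightarrow> bool" where
  "has_left_qadjoint Q C D G \<longleftrightarrow> qfunctor Q C D G \<and>
     (\<exists>F. qfunctor Q D C F \<and> qtrans Q D D id (G \<circ> F) \<and> qtrans Q C C (F \<circ> G) id)"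

definition presheaf :: "('q, 'a) quant \<Rightarrow> ('c, 'q, 'a) qcat \<Rightarrow> 'q \<Rightarrow> ('c \<Rightarrow> 'a) \<Rightarrow> bool" where
  "presheaf Q C A \<phi> \<longleftrightarrow> A \<in> QOb Q \<and> \<phi> \<in> extensional (EOb C) \<and>
     (\<forall>x\<in>EOb C. \<phi> x \<in> carrier (QHom Q (ext C x) A)) \<and>
     (\<forall>x\<in>EOb C. \<forall>y\<in>EOb C. \<phi> y \<bullet>\<^bsub>Q\<^esub> EHom C x y \<sqsubseteq>\<^bsub>QHom Q (ext C x) A\<^esub> \<phi> x)"

definition presheaf_qcat ::
  "('q, 'a) quant \<Rightarrow> ('c, 'q, 'a) qcat \<Rightarrow> ('q \<times> ('c \<Rightarrow> 'a), 'q, 'a) qcat" where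
  "presheaf_qcat Q C = \<lparr>
     EOb = {(A, \<phi>). presheaf Q C A \<phi>},
     ext = fst,
     EHom = (\<lambda>(A, \<phi>) (B, \<psi>).
       \<Sqinter>\<^bsub>QHom Q A B\<^esub> ((\<lambda>x. q_res Q (ext C x) A B (\<phi> x) (\<psi> x)) ` EOb C))\<rparr>"

definition qyoneda :: "('c, 'q, 'a) qcat \<Rightarrow> 'c \<Rightarrow> 'q \<times> ('c \<Rightarrow> 'a)" where
  "qyoneda C x = (ext C x, \<lambda>y\<in>EOb C. EHom C y x)"

definition qtotal :: "('q, 'a) quant \<Rightarrow> ('c, 'q, 'a) qcat \<Rightarrow> bool" where
  "qtotal Q C \<longleftrightarrow> has_left_qadjoint Q C (presheaf_qcat Q C) (qyoneda C)"


section \<open>The free quantaloid, and the enriched category of a faithful functor\<close>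

definition free_quantaloid :: "('o, 'm) cat \<Rightarrow> ('o, 'm set) quant" where
  "free_quantaloid B = \<lparr>
     QOb = Ob B,
     QHom = (\<lambda>X Y. \<lparr>carrier = Pow (Hom B X Y), eq = (=), le = (\<subseteq>)\<rparr>),
     QIdt = (\<lambda>X. {Idt B X}),
     QComp = (\<lambda>V U. {v \<cdot>\<^bsub>B\<^esub> u | v u. v \<in> V \<and> u \<in> U})\<rparr>"

definition qcat_of_functor ::
  "('oe, 'me) cat \<Rightarrow> ('oe, 'me, 'ob, 'mb) func \<Rightarrow> ('oe, 'ob, 'mb set) qcat" where
  "qcat_of_functor E p = \<lparr>EOb = Ob E, ext = fob p, EHom = (\<lambda>x y. far p x y ` Hom E x y)\<rparr>"

lemma free_quantaloid_sup:
  assumes "S \<subseteq> Pow (Hom B X Y)"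
  shows "\<Squnion>\<^bsub>QHom (free_quantaloid B) X Y\<^esub> S = \<Union> S"
  unfolding sup_def
proof (rule some_equality)
  show "least (QHom (free_quantaloid B) X Y) (\<Union> S) (Upper (QHom (free_quantaloid B) X Y) S)"
    using assms by (auto simp: free_quantaloid_def least_def Upper_def) blast
next
  fix U
  assume U: "least (QHom (free_quantaloid B) X Y) U (Upper (QHom (free_quantaloid B) X Y) S)"
  have "\<Union> S \<subseteq> Hom B X Y"
    using assms by blast
  then have "U \<subseteq> \<Union> S"
    using U by (auto simp: free_quantaloid_def least_def Upper_def)
  moreover have "\<Union> S \<subseteq> U"
    using U assms by (simp add: free_quantaloid_def least_def Upper_def) blast
  ultimately show "U = \<Union> S"
    by simp
qed

lemma quantaloid_free_quantaloid:
  assumes "category B"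
  shows "quantaloid (free_quantaloid B)"
proof -
  interpret B: category B by fact
  have cat: "category (quant_cat (free_quantaloid B))"
  proof (unfold_locales, goal_cases)
    case (1 x)
    then show ?case by (simp add: quant_cat_def free_quantaloid_def B.idt_in)
  next
    case (2 x y z f g)
    then show ?case
      by (auto simp: quant_cat_def free_quantaloid_def intro: B.comp_in)
  next
    case (3 x y f)
    then have "v \<cdot>\<^bsub>B\<^esub> Idt B x = v" if "v \<in> f" for v
      using that by (auto simp: quant_cat_def free_quantaloid_def intro: B.comp_idt)
    then show ?case by (force simp: quant_cat_def free_quantaloid_def)
  next
    case (4 x y f)
    then have "Idt B y \<cdot>\<^bsub>B\<^esub> v = v" if "v \<in> f" for v
      using that by (auto simp: quant_cat_def free_quantaloid_def intro: B.idt_comp)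
    then show ?case by (force simp: quant_cat_def free_quantaloid_def)
  next
    case (5 w x y z f g h)
    then have assoc: "(c \<cdot>\<^bsub>B\<^esub> b) \<cdot>\<^bsub>B\<^esub> a = c \<cdot>\<^bsub>B\<^esub> (b \<cdot>\<^bsub>B\<^esub> a)" if "a \<in> f" "b \<in> g" "c \<in> h" for a b c
      using that B.comp_assoc[of w x y z a b c]
      by (auto simp: quant_cat_def free_quantaloid_def)
    have "t \<in> {v \<cdot>\<^bsub>B\<^esub> u |v u. v \<in> {v \<cdot>\<^bsub>B\<^esub> u |v u. v \<in> h \<and> u \<in> g} \<and> u \<in> f} \<longleftrightarrow>
        (\<exists>a\<in>f. \<exists>b\<in>g. \<exists>c\<in>h. t = (c \<cdot>\<^bsub>B\<^esub> b) \<cdot>\<^bsub>B\<^esub> a)" for t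
      by blast
    moreover have "t \<in> {v \<cdot>\<^bsub>B\<^esub> u |v u. v \<in> h \<and> u \<in> {v \<cdot>\<^bsub>B\<^esub> u |v u. v \<in> g \<and> u \<in> f}} \<longleftrightarrow>
        (\<exists>a\<in>f. \<exists>b\<in>g. \<exists>c\<in>h. t = c \<cdot>\<^bsub>B\<^esub> (b \<cdot>\<^bsub>B\<^esub> a))" for t
      by blast
    ultimately show ?case
      by (simp add: quant_cat_def free_quantaloid_def set_eq_iff assoc)
  qed
  have lat: "complete_lattice (QHom (free_quantaloid B) X Y)" for X Y
  proof (unfold_locales, goal_cases)
    case (9 S)
    then show ?case
      by (intro exI[of _ "\<Union> S"]) (auto simp: free_quantaloid_def least_def Upper_def, blast)
  next
    case (10 S)
    then show ?case
      by (intro exI[of _ "\<Inter> S \<inter> Hom B X Y"])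
        (auto simp: free_quantaloid_def greatest_def Lower_def, blast)
  qed (auto simp: free_quantaloid_def)
  show ?thesis
  proof (rule quantaloid.intro, goal_cases)
    case 1
    show ?case by (fact cat)
  next
    case (2 X Y)
    show ?case by (fact lat)
  next
    case (3 X Y Z g S)
    have S: "S \<subseteq> Pow (Hom B X Y)"
      using 3 by (simp add: free_quantaloid_def)
    have S': "(\<lambda>f. g \<bullet>\<^bsub>free_quantaloid B\<^esub> f) ` S \<subseteq> Pow (Hom B X Z)"
      using 3 by (auto simp: free_quantaloid_def intro!: B.comp_in[of X Y Z])
    show ?case
      unfolding free_quantaloid_sup[OF S] free_quantaloid_sup[OF S']
      by (simp add: free_quantaloid_def) blast
  next
    case (4 X Y Z f S)
    have S: "S \<subseteq> Pow (Hom B Y Z)"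
      using 4 by (simp add: free_quantaloid_def)
    have S': "(\<lambda>g. g \<bullet>\<^bsub>free_quantaloid B\<^esub> f) ` S \<subseteq> Pow (Hom B X Z)"
      using 4 by (auto simp: free_quantaloid_def intro!: B.comp_in[of X Y Z])
    show ?case
      unfolding free_quantaloid_sup[OF S] free_quantaloid_sup[OF S']
      by (simp add: free_quantaloid_def) blast
  qed
qed

lemma qcategory_qcat_of_functor:
  assumes "category E" and "category B" and "cat_functor E B p"
  shows "qcategory (free_quantaloid B) (qcat_of_functor E p)"
proof -
  interpret p: cat_functor E B p by fact
  interpret Q: quantaloid "free_quantaloid B"
    using assms(2) by (rule quantaloid_free_quantaloid)
  show ?thesis
    by unfold_locales
      (auto simp: free_quantaloid_def qcat_of_functor_def p.fob_in p.far_in p.C.idt_in p.C.comp_in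
        simp flip: p.far_idt p.far_comp)
qed

end

theory Submission
  imports Defs
begin

text \<open>
  A family of maps into \<open>z\<close> and the sieve it generates have the same final liftings. A final
  lifting of a sieve \<open>\<phi>\<close> on \<open>z\<close> is an object \<open>z'\<close> over \<open>z\<close> such that the same maps of the base
  lift to \<open>z' \<rightarrow> e\<close> and to \<open>\<phi> \<rightarrow> Y e\<close>. Over faithful functors, and likewise for enriched functors,
  such a pointwise representation is all that a left adjoint amounts to: functoriality, naturality
  and the triangle identities are automatic. Finally, the presheaves on the enriched category are
  the sieves, with the same liftable maps as homs.
\<close>

section \<open>Left adjoints over a base\<close>

lemma functor_over_id:
  assumes "cat_functor C B p"
  shows "functor_over B C p C p id_func"
proof -
  interpret p: cat_functor C B p by fact
  have "cat_functor C C id_func"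
    by unfold_locales (auto simp: id_func_def)
  then show ?thesis
    using assms by (simp add: functor_over_def id_func_def)
qed

lemma functor_over_comp:
  assumes F: "functor_over B C p D q F" and G: "functor_over B D q D' r G"
  shows "functor_over B C p D' r (comp_func G F)"
proof -
  interpret F: cat_functor C D F using F by (simp add: functor_over_def)
  interpret G: cat_functor D D' G using G by (simp add: functor_over_def)
  have "cat_functor C D' (comp_func G F)"
    by unfold_locales
      (simp_all add: comp_func_def F.fob_in G.fob_in F.far_in G.far_in F.far_idt G.far_idt
        F.far_comp G.far_comp[OF F.fob_in F.fob_in F.fob_in])
  then show ?thesis
    using F G by (simp add: functor_over_def comp_func_def F.fob_in F.far_in)
qed

lemma faithful_eqI:
  assumes "faithful C p" and "x \<in> Ob C" "y \<in> Ob C" and "f \<in> Hom C x y" "g \<in> Hom C x y"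
    and "far p x y f = far p x y g"
  shows "f = g"
  using assms unfolding faithful_def inj_on_def by blast

text \<open>Both composites of a naturality square are parallel maps of \<open>D\<close>. Since
  \<open>F\<close> and \<open>G\<close> commute with the projections and the components lie over
  identities, \<open>q\<close> sends both to \<open>far p x y f\<close>, and faithfulness of
  \<open>q\<close> makes them equal.\<close>

lemma nat_trans_over_faithfulI:
  assumes F: "functor_over B C p D q F" and G: "functor_over B C p D q G"
    and q: "faithful D q"
    and \<tau>: "\<And>x. x \<in> Ob C \<Longrightarrow> \<tau> x \<in> Hom D (fob F x) (fob G x)"
      "\<And>x. x \<in> Ob C \<Longrightarrow> far q (fob F x) (fob G x) (\<tau> x) = Idt B (fob p x)"
  shows "nat_trans_over B C D q F G \<tau>"
proof -
  interpret p: cat_functor C B p using F by (simp add: functor_over_def)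
  interpret q: cat_functor D B q using F by (simp add: functor_over_def)
  interpret F: cat_functor C D F using F by (simp add: functor_over_def)
  interpret G: cat_functor C D G using G by (simp add: functor_over_def)
  have over: "far q (fob F x) (fob F y) (far F x y f) = far p x y f"
    "far q (fob G x) (fob G y) (far G x y f) = far p x y f"
    "fob q (fob F x) = fob p x"
    if "x \<in> Ob C" "y \<in> Ob C" "f \<in> Hom C x y" for x y f
    using that F G by (simp_all add: functor_over_def)
  have "\<tau> y \<cdot>\<^bsub>D\<^esub> far F x y f = far G x y f \<cdot>\<^bsub>D\<^esub> \<tau> x"
    if x: "x \<in> Ob C" and y: "y \<in> Ob C" and f: "f \<in> Hom C x y" for x y f
  proof (rule faithful_eqI[OF q F.fob_in[OF x] G.fob_in[OF y]])
    note [simp] = p.D.comp_idt[OF p.fob_in p.fob_in p.far_in] p.D.idt_comp[OF p.fob_in p.fob_in p.far_in]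
    show "\<tau> y \<cdot>\<^bsub>D\<^esub> far F x y f \<in> Hom D (fob F x) (fob G y)"
      by (rule q.C.comp_in[of _ "fob F y"]) (simp_all add: x y f \<tau> F.fob_in G.fob_in F.far_in)
    show "far G x y f \<cdot>\<^bsub>D\<^esub> \<tau> x \<in> Hom D (fob F x) (fob G y)"
      by (rule q.C.comp_in[of _ "fob G x"]) (simp_all add: x y f \<tau> F.fob_in G.fob_in G.far_in)
    have "far q (fob F x) (fob G y) (\<tau> y \<cdot>\<^bsub>D\<^esub> far F x y f) = far p x y f"
      using q.far_comp[of "fob F x" "fob F y" "fob G y" "far F x y f" "\<tau> y"]
      by (simp add: x y f \<tau> F.fob_in G.fob_in F.far_in over[OF x y f])
    moreover have "far q (fob F x) (fob G y) (far G x y f \<cdot>\<^bsub>D\<^esub> \<tau> x) = far p x y f"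
      using q.far_comp[of "fob F x" "fob G x" "fob G y" "\<tau> x" "far G x y f"]
      by (simp add: x y f \<tau> F.fob_in G.fob_in G.far_in over[OF x y f])
    ultimately show "far q (fob F x) (fob G y) (\<tau> y \<cdot>\<^bsub>D\<^esub> far F x y f) =
        far q (fob F x) (fob G y) (far G x y f \<cdot>\<^bsub>D\<^esub> \<tau> x)"
      by simp
  qed
  then show ?thesis
    using F \<tau> by (simp add: nat_trans_over_def nat_trans_def functor_over_def)
qed

text \<open>With \<open>lifts_idt\<close>, this lets liftable base maps be composed directly, so
  that no morphism upstairs has to be chosen until an adjunction is assembled.\<close>

lemma (in cat_functor) lifts_comp:
  assumes "x \<in> Ob C" "y \<in> Ob C" "z \<in> Ob C" and "lifts C F h x y" and "lifts C F k y z"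
  shows "lifts C F (k \<cdot>\<^bsub>D\<^esub> h) x z"
  using assms C.comp_in unfolding lifts_def by (metis far_comp)

lemma (in cat_functor) lifts_idt:
  assumes "x \<in> Ob C"
  shows "lifts C F (Idt D (fob F x)) x x"
  using assms C.idt_in unfolding lifts_def by (metis far_idt)

lemma functor_over_lifts:
  assumes "functor_over B C p D q F" and "x \<in> Ob C" "y \<in> Ob C" and "lifts C p k x y"
  shows "lifts D q k (fob F x) (fob F y)"
  using assms unfolding functor_over_def lifts_def by (metis cat_functor.far_in)

text \<open>
  Over faithful functors the hom-sets of \<open>C\<close> and \<open>D\<close> are the sets of liftable maps of the base,
  so a left adjoint is just a choice of objects with the correct liftable maps out of them.
\<close>

lemma has_left_adjoint_over_iff:
  assumes G: "functor_over B C p D q G" and p: "faithful C p" and q: "faithful D q"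
  shows "has_left_adjoint_over B C p D q G \<longleftrightarrow>
    (\<forall>d\<in>Ob D. \<exists>c'\<in>Ob C. fob p c' = fob q d \<and> (\<forall>c\<in>Ob C. \<forall>\<theta>\<in>Hom B (fob q d) (fob p c).
       lifts C p \<theta> c' c \<longleftrightarrow> lifts D q \<theta> d (fob G c)))"
    (is "?adj \<longleftrightarrow> (\<forall>d\<in>Ob D. \<exists>c'\<in>Ob C. ?repr d c')")
proof -
  interpret p: cat_functor C B p using G by (simp add: functor_over_def)
  interpret q: cat_functor D B q using G by (simp add: functor_over_def)
  interpret G: cat_functor C D G using G by (simp add: functor_over_def)
  have qG: "fob q (fob G c) = fob p c" if "c \<in> Ob C" for c
    using G that by (simp add: functor_over_def)
  show ?thesis
  proof
    assume ?adj
    then obtain F \<eta> \<epsilon> where F: "functor_over B D q C p F"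
      and \<eta>: "nat_trans_over B D D q id_func (comp_func G F) \<eta>"
      and \<epsilon>: "nat_trans_over B C C p (comp_func F G) id_func \<epsilon>"
      by (auto simp: has_left_adjoint_over_def adjunction_over_def)
    interpret F: cat_functor D C F using F by (simp add: functor_over_def)
    have pF: "fob p (fob F d) = fob q d" if "d \<in> Ob D" for d
      using F that by (simp add: functor_over_def)
    have unit: "lifts D q (Idt B (fob q d)) d (fob G (fob F d))" if "d \<in> Ob D" for d
      using \<eta> that
      by (force simp: lifts_def nat_trans_over_def nat_trans_def id_func_def comp_func_def)
    have counit: "lifts C p (Idt B (fob p c)) (fob F (fob G c)) c" if "c \<in> Ob C" for c
      using \<epsilon> that G.fob_in[OF that]
      by (force simp: lifts_def nat_trans_over_def nat_trans_def id_func_def comp_func_def pF qG)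
    \<comment> \<open>Transposition, read off in the base. A lift \<open>F d \<rightarrow> c\<close>
      of \<theta> is sent by \<open>G\<close> to a lift \<open>G (F d) \<rightarrow> G c\<close> and
      precomposed with the unit; a lift \<open>d \<rightarrow> G c\<close> is sent by
      \<open>F\<close> and postcomposed with the counit. Unit and counit lie over identities, so the
      composite still lies over \<theta>.\<close>
    have "?repr d (fob F d)" if d: "d \<in> Ob D" for d
    proof (intro conjI ballI iffI)
      show "fob p (fob F d) = fob q d"
        using d by (rule pF)
    next
      fix c \<theta>
      assume c: "c \<in> Ob C" and \<theta>: "\<theta> \<in> Hom B (fob q d) (fob p c)"
      have \<theta>_id: "\<theta> \<cdot>\<^bsub>B\<^esub> Idt B (fob q d) = \<theta>" "Idt B (fob p c) \<cdot>\<^bsub>B\<^esub> \<theta> = \<theta>"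
        using p.D.comp_idt p.D.idt_comp p.fob_in[OF c] q.fob_in[OF d] \<theta> by auto
      show "lifts D q \<theta> d (fob G c)" if "lifts C p \<theta> (fob F d) c"
        using q.lifts_comp[OF d _ _ unit[OF d] functor_over_lifts[OF G F.fob_in[OF d] c that]]
        by (simp add: c d F.fob_in G.fob_in \<theta>_id)
      show "lifts C p \<theta> (fob F d) c" if "lifts D q \<theta> d (fob G c)"
        using p.lifts_comp[OF _ _ c functor_over_lifts[OF F d G.fob_in[OF c] that] counit[OF c]]
        by (simp add: c d F.fob_in G.fob_in \<theta>_id)
    qed
    then show "\<forall>d\<in>Ob D. \<exists>c'\<in>Ob C. ?repr d c'"
      using F.fob_in by blast
  next
    assume "\<forall>d\<in>Ob D. \<exists>c'\<in>Ob C. ?repr d c'"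
    then obtain L where L: "\<And>d. d \<in> Ob D \<Longrightarrow> L d \<in> Ob C \<and> ?repr d (L d)"
      by metis
    then have L_in: "L d \<in> Ob C" and pL: "fob p (L d) = fob q d" if "d \<in> Ob D" for d
      using that by auto
    have L_iff: "lifts C p \<theta> (L d) c \<longleftrightarrow> lifts D q \<theta> d (fob G c)"
      if "d \<in> Ob D" "c \<in> Ob C" "\<theta> \<in> Hom B (fob q d) (fob p c)" for d c \<theta>
      using that L by blast
    \<comment> \<open>A choice function for lifts in \<open>C\<close>; by faithfulness of
      \<open>p\<close> there is at most one lift to choose.\<close>
    define lift where "lift x y k = (SOME f. f \<in> Hom C x y \<and> far p x y f = k)" for x y k
    have lift: "lift x y k \<in> Hom C x y" "far p x y (lift x y k) = k"
      if "lifts C p k x y" for x y k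
      using someI_ex[of "\<lambda>f. f \<in> Hom C x y \<and> far p x y f = k"] that
      by (auto simp: lift_def lifts_def)
    \<comment> \<open>Yoneda-style: the unit is the transpose of the identity on \<open>L d\<close>,
      and below the counit is that of the identity on \<open>G c\<close>. In both cases
      \<open>L_iff\<close> is applied to an identity of the base.\<close>
    have unit: "lifts D q (Idt B (fob q d)) d (fob G (L d))" if d: "d \<in> Ob D" for d
      using L_iff[OF d L_in[OF d]] p.lifts_idt[OF L_in[OF d]] p.D.idt_in[OF q.fob_in[OF d]]
      by (simp add: d pL)
    have counit: "lifts C p (Idt B (fob p c)) (L (fob G c)) c" if c: "c \<in> Ob C" for c
      using L_iff[OF G.fob_in[OF c] c] q.lifts_idt[OF G.fob_in[OF c]] p.D.idt_in[OF p.fob_in[OF c]]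
      by (simp add: c qG)
    define F where "F = \<lparr>fob = L, far = (\<lambda>d d' g. lift (L d) (L d') (far q d d' g))\<rparr>"
    \<comment> \<open>Following \<open>g\<close> by the unit at \<open>d'\<close> gives a lift
      \<open>d \<rightarrow> G (L d')\<close> of \<open>far q d d' g\<close>, which
      \<open>L_iff\<close> transposes to a map out of \<open>L d\<close>.\<close>
    have ar: "lifts C p (far q d d' g) (L d) (L d')"
      if d: "d \<in> Ob D" "d' \<in> Ob D" and g: "g \<in> Hom D d d'" for d d' g
    proof -
      have "lifts D q (far q d d' g) d d'"
        using g by (auto simp: lifts_def)
      from q.lifts_comp[OF d G.fob_in[OF L_in] this unit] d
      have "lifts D q (Idt B (fob q d') \<cdot>\<^bsub>B\<^esub> far q d d' g) d (fob G (L d'))"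
        by simp
      then show ?thesis
        using d g by (simp add: L_iff L_in pL q.far_in p.D.idt_comp[OF q.fob_in q.fob_in])
    qed
    \<comment> \<open>The functor laws are equations between parallel maps of \<open>C\<close>.
      Their images under \<open>p\<close> are the corresponding laws for \<open>q\<close>, so
      faithfulness suffices.\<close>
    have F_functor: "cat_functor D C F"
    proof (unfold_locales, goal_cases)
      case (1 x)
      then show ?case by (simp add: F_def L_in)
    next
      case (2 x y f)
      then show ?case by (simp add: F_def lift ar)
    next
      case (3 x)
      have l: "lifts C p (far q x x (Idt D x)) (L x) (L x)"
        using 3 by (simp add: ar q.C.idt_in)
      show ?case
        using 3 lift[OF l] L_in[OF 3]
        by (auto simp: F_def p.far_idt q.far_idt pL p.C.idt_in intro!: faithful_eqI[OF p, of "L x" "L x"])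
    next
      case (4 x y z f g)
      have fg: "g \<cdot>\<^bsub>D\<^esub> f \<in> Hom D x z"
        using 4 by (blast intro: q.C.comp_in)
      note L4 = L_in[OF 4(1)] L_in[OF 4(2)] L_in[OF 4(3)]
      note f = lift[OF ar[OF 4(1,2,4)]] and g = lift[OF ar[OF 4(2,3,5)]]
      show ?case
        unfolding F_def func.simps
        using lift[OF ar[OF 4(1,3) fg]] p.C.comp_in[OF L4 f(1) g(1)] p.far_comp[OF L4 f(1) g(1)]
        by (intro faithful_eqI[OF p L4(1,3)]) (simp_all add: f g q.far_comp[OF 4])
    qed
    have F: "functor_over B D q C p F"
      using F_functor p.cat_functor_axioms q.cat_functor_axioms
      by (simp add: functor_over_def F_def pL lift ar)
    interpret F: cat_functor D C F by fact
    obtain \<eta> where \<eta>: "\<And>d. d \<in> Ob D \<Longrightarrow> \<eta> d \<in> Hom D d (fob G (L d))"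
      "\<And>d. d \<in> Ob D \<Longrightarrow> far q d (fob G (L d)) (\<eta> d) = Idt B (fob q d)"
      using unit unfolding lifts_def by metis
    define \<epsilon> where "\<epsilon> c = lift (L (fob G c)) c (Idt B (fob p c))" for c
    have \<epsilon>: "\<epsilon> c \<in> Hom C (L (fob G c)) c" "far p (L (fob G c)) c (\<epsilon> c) = Idt B (fob p c)"
      if "c \<in> Ob C" for c
      using lift[OF counit[OF that]] by (auto simp: \<epsilon>_def)
    have F_ar: "far F x y f \<in> Hom C (L x) (L y)" "far p (L x) (L y) (far F x y f) = far q x y f"
      if "x \<in> Ob D" "y \<in> Ob D" "f \<in> Hom D x y" for x y f
      using that by (simp_all add: F_def lift ar)
    have G_ar: "far q (fob G x) (fob G y) (far G x y f) = far p x y f"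
      if "x \<in> Ob C" "y \<in> Ob C" "f \<in> Hom C x y" for x y f
      using that G by (simp add: functor_over_def)
    have idt_idt: "Idt B z \<cdot>\<^bsub>B\<^esub> Idt B z = Idt B z" if "z \<in> Ob B" for z
      using that by (simp add: p.D.comp_idt[of z z] p.D.idt_in)
    have "nat_trans_over B D D q id_func (comp_func G F) \<eta>"
      using functor_over_id[OF q.cat_functor_axioms] functor_over_comp[OF F G] q
      by (rule nat_trans_over_faithfulI) (auto simp: id_func_def comp_func_def F_def \<eta>)
    moreover have "nat_trans_over B C C p (comp_func F G) id_func \<epsilon>"
      using functor_over_comp[OF G F] functor_over_id[OF p.cat_functor_axioms] p
      by (rule nat_trans_over_faithfulI) (auto simp: id_func_def comp_func_def F_def \<epsilon>)
    \<comment> \<open>In either triangle identity both factors lie over the same identity of the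
      base, hence so does their composite; faithfulness of \<open>p\<close> here, and of
      \<open>q\<close> for the second triangle, concludes.\<close>
    moreover have "\<epsilon> (L d) \<cdot>\<^bsub>C\<^esub> far F d (fob G (L d)) (\<eta> d) = Idt C (L d)" if d: "d \<in> Ob D" for d
    proof -
      have GLd: "fob G (L d) \<in> Ob D"
        using d by (simp add: L_in G.fob_in)
      show ?thesis
        using p.C.comp_in[OF L_in[OF d] L_in[OF GLd] L_in[OF d] F_ar(1)[OF d GLd \<eta>(1)[OF d]]
            \<epsilon>(1)[OF L_in[OF d]]]
          p.far_comp[OF L_in[OF d] L_in[OF GLd] L_in[OF d] F_ar(1)[OF d GLd \<eta>(1)[OF d]]
            \<epsilon>(1)[OF L_in[OF d]]]
        by (intro faithful_eqI[OF p L_in[OF d] L_in[OF d]])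
          (simp_all add: d GLd L_in \<eta> \<epsilon> F_ar p.C.idt_in p.far_idt pL idt_idt q.fob_in)
    qed
    moreover have "far G (L (fob G c)) c (\<epsilon> c) \<cdot>\<^bsub>D\<^esub> \<eta> (fob G c) = Idt D (fob G c)"
      if c: "c \<in> Ob C" for c
    proof -
      note Gc = G.fob_in[OF c]
      note LGc = L_in[OF Gc]
      show ?thesis
        using q.C.comp_in[OF Gc G.fob_in[OF LGc] Gc \<eta>(1)[OF Gc] G.far_in[OF LGc c \<epsilon>(1)[OF c]]]
          q.far_comp[OF Gc G.fob_in[OF LGc] Gc \<eta>(1)[OF Gc] G.far_in[OF LGc c \<epsilon>(1)[OF c]]]
        by (intro faithful_eqI[OF q Gc Gc])
          (simp_all add: c Gc LGc \<eta> \<epsilon> G_ar q.C.idt_in q.far_idt qG idt_idt p.fob_in)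
    qed
    ultimately have "adjunction_over B C p D q F G \<eta> \<epsilon>"
      using F G by (simp add: adjunction_over_def F_def)
    then show ?adj
      by (auto simp: has_left_adjoint_over_def)
  qed
qed


section \<open>Final liftings of sieves\<close>

context
  fixes E :: "('oe, 'me) cat" and B :: "('ob, 'mb) cat" and p :: "('oe, 'me, 'ob, 'mb) func"
  assumes p: "cat_functor E B p"
begin

interpretation p: cat_functor E B p by (fact p)

text \<open>The closure of the family under precomposition with images of maps of \<open>E\<close>.
  The empty value off \<open>Ob E\<close> is the one that \<open>p_sieve\<close> prescribes.\<close>

definition generated_sieve :: "'i set \<Rightarrow> ('i \<Rightarrow> 'oe) \<Rightarrow> ('i \<Rightarrow> 'mb) \<Rightarrow> 'oe \<Rightarrow> 'mb set" where
  "generated_sieve I x g y =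
     (if y \<in> Ob E then {g i \<cdot>\<^bsub>B\<^esub> far p y (x i) h |i h. i \<in> I \<and> h \<in> Hom E y (x i)} else {})"

text \<open>Precomposing a member that factors through \<open>h\<close> with the image of
  \<open>k\<close> gives the member for the same index that factors through
  \<open>h \<cdot> k\<close>, by functoriality and associativity.\<close>

lemma p_sieve_generated_sieve:
  assumes z: "z \<in> Ob B" and fam: "\<And>i. i \<in> I \<Longrightarrow> x i \<in> Ob E \<and> g i \<in> Hom B (fob p (x i)) z"
  shows "p_sieve E B p z (generated_sieve I x g)"
proof -
  have "g i \<cdot>\<^bsub>B\<^esub> far p y (x i) h \<in> Hom B (fob p y) z"
    if "y \<in> Ob E" "i \<in> I" "h \<in> Hom E y (x i)" for y i h
    using that fam[of i] z p.D.comp_in[of "fob p y" "fob p (x i)" z] by (simp add: p.fob_in p.far_in)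
  moreover have "\<exists>j k'. (g i \<cdot>\<^bsub>B\<^esub> far p y (x i) h) \<cdot>\<^bsub>B\<^esub> far p w y k = g j \<cdot>\<^bsub>B\<^esub> far p w (x j) k' \<and>
      j \<in> I \<and> k' \<in> Hom E w (x j)"
    if "w \<in> Ob E" "y \<in> Ob E" "i \<in> I" "h \<in> Hom E y (x i)" "k \<in> Hom E w y" for w y i h k
    using that fam[of i] z
    by (intro exI[of _ i] exI[of _ "h \<cdot>\<^bsub>E\<^esub> k"])
      (simp add: p.far_comp p.C.comp_in[of w y] p.fob_in p.far_in
        p.D.comp_assoc[of "fob p w" "fob p y" "fob p (x i)" z])
  ultimately show ?thesis
    by (auto simp: p_sieve_def generated_sieve_def)
qed

text \<open>The tests on \<theta> agree. Each \<open>g i\<close> lies in the sieve, and if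
  \<open>\<theta> \<cdot> g i\<close> lifts, so does its composite with any map in the image of
  \<open>p\<close>.\<close>

lemma final_lifting_generated_sieve:
  assumes z: "z \<in> Ob B" and fam: "\<And>i. i \<in> I \<Longrightarrow> x i \<in> Ob E \<and> g i \<in> Hom B (fob p (x i)) z"
  shows "final_lifting E B p z (SIGMA y:Ob E. generated_sieve I x g y) fst snd z' \<longleftrightarrow>
    final_lifting E B p z I x g z'"
proof -
  have "(\<forall>j \<in> (SIGMA y:Ob E. generated_sieve I x g y). lifts E p (\<theta> \<cdot>\<^bsub>B\<^esub> snd j) (fst j) e) \<longleftrightarrow>
      (\<forall>i\<in>I. lifts E p (\<theta> \<cdot>\<^bsub>B\<^esub> g i) (x i) e)" (is "?all \<longleftrightarrow> ?gens")
    if e: "e \<in> Ob E" and \<theta>: "\<theta> \<in> Hom B z (fob p e)" for e \<theta>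
  proof
    assume ?all
    show ?gens
    proof
      fix i
      assume i: "i \<in> I"
      \<comment> \<open>The generator itself is recovered by taking the identity of
        \<open>x i\<close> as the factor from \<open>E\<close>.\<close>
      have "g i \<cdot>\<^bsub>B\<^esub> far p (x i) (x i) (Idt E (x i)) = g i"
        using fam[OF i] z p.D.comp_idt[of "fob p (x i)" z] by (simp add: p.far_idt p.fob_in)
      then have "g i \<in> generated_sieve I x g (x i)"
        using fam[OF i] i p.C.idt_in[of "x i"] unfolding generated_sieve_def
        by (simp, metis)
      then show "lifts E p (\<theta> \<cdot>\<^bsub>B\<^esub> g i) (x i) e"
        using \<open>?all\<close> fam[OF i] by force
    qed
  next
    assume gens: ?gens
    have "lifts E p (\<theta> \<cdot>\<^bsub>B\<^esub> (g i \<cdot>\<^bsub>B\<^esub> far p y (x i) h)) y e"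
      if y: "y \<in> Ob E" and i: "i \<in> I" and h: "h \<in> Hom E y (x i)" for y i h
    proof -
      have "lifts E p (far p y (x i) h) y (x i)"
        using h by (auto simp: lifts_def)
      then have "lifts E p ((\<theta> \<cdot>\<^bsub>B\<^esub> g i) \<cdot>\<^bsub>B\<^esub> far p y (x i) h) y e"
        using gens fam[OF i] y e i by (blast intro: p.lifts_comp)
      then show ?thesis
        using fam[OF i] y e h z \<theta> p.D.comp_assoc[of "fob p y" "fob p (x i)" z "fob p e"]
        by (simp add: p.fob_in p.far_in)
    qed
    then show ?all
      by (auto simp: generated_sieve_def)
  qed
  then show ?thesis
    by (simp add: final_lifting_def)
qed

text \<open>A sieve is the family of its own members, indexed by pairs of an object and a map;
  conversely a family is lifted by lifting the sieve it generates.\<close>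

lemma topological_iff_admits_sieve_liftings:
  "topological E B p \<longleftrightarrow> admits_sieve_liftings E B p"
proof
  assume top: "topological E B p"
  show "admits_sieve_liftings E B p"
    unfolding admits_sieve_liftings_def
  proof (intro ballI allI impI)
    fix z \<phi>
    assume z: "z \<in> Ob B" and \<phi>: "p_sieve E B p z \<phi>"
    have "fst i \<in> Ob E \<and> snd i \<in> Hom B (fob p (fst i)) z" if "i \<in> (SIGMA x:Ob E. \<phi> x)" for i
      using \<phi> that unfolding p_sieve_def by (cases i) (simp, blast)
    with top z show "\<exists>z'. final_lifting E B p z (SIGMA x:Ob E. \<phi> x) fst snd z'"
      by (rule topological_final_lifting)
  qed
next
  assume "admits_sieve_liftings E B p"
  then show "topological E B p"
    unfolding admits_sieve_liftings_def topological_def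
    by (metis p_sieve_generated_sieve final_lifting_generated_sieve)
qed

text \<open>\<open>sieve_proj\<close> leaves maps unchanged, so \<theta> can only lift to itself;
  and lying in the sieve of \<open>e\<close> means being the image of a map into
  \<open>e\<close>.\<close>

lemma lifts_sieve_proj_iff:
  "lifts (sieve_cat E B p) sieve_proj \<theta> (z, \<phi>) (fob (sieve_yoneda E p) e) \<longleftrightarrow>
    \<theta> \<in> Hom B z (fob p e) \<and> (\<forall>x\<in>Ob E. \<forall>f\<in>\<phi> x. lifts E p (\<theta> \<cdot>\<^bsub>B\<^esub> f) x e)"
  by (auto simp: lifts_def sieve_cat_def sieve_proj_def sieve_yoneda_def image_iff)

text \<open>This puts final liftings into the shape of the representation condition in
  \<open>has_left_adjoint_over_iff\<close>, with \<open>sieve_yoneda\<close> as the right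
  adjoint.\<close>

lemma final_lifting_sieve_iff:
  "final_lifting E B p z (SIGMA x:Ob E. \<phi> x) fst snd z' \<longleftrightarrow>
    z' \<in> Ob E \<and> fob p z' = z \<and> (\<forall>e\<in>Ob E. \<forall>\<theta>\<in>Hom B z (fob p e).
      lifts E p \<theta> z' e \<longleftrightarrow>
        lifts (sieve_cat E B p) sieve_proj \<theta> (z, \<phi>) (fob (sieve_yoneda E p) e))"
  by (auto simp: final_lifting_def lifts_sieve_proj_iff)

lemma admits_sieve_liftings_iff_left_adjoint:
  assumes "faithful E p"
  shows "admits_sieve_liftings E B p \<longleftrightarrow>
    has_left_adjoint_over B E p (sieve_cat E B p) sieve_proj (sieve_yoneda E p)"
proof -
  have "functor_over B E p (sieve_cat E B p) sieve_proj (sieve_yoneda E p)"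
    using p.C.category_axioms p.D.category_axioms p by (rule functor_over_sieve_yoneda)
  from has_left_adjoint_over_iff[OF this assms faithful_sieve_proj] show ?thesis
    by (auto simp: admits_sieve_liftings_def final_lifting_sieve_iff Bex_def conj_assoc
        sieve_cat_def[THEN arg_cong, of Ob] sieve_proj_def[THEN arg_cong, of fob])
qed

end


section \<open>Left adjoints of enriched functors\<close>

context quantaloid
begin

text \<open>Expresses the order through binary joins, so that preservation of joins by composition
  yields the monotonicity lemmas that follow.\<close>

lemma sup_pair:
  assumes A: "A \<in> QOb Q" and B: "B \<in> QOb Q"
    and f: "f \<in> carrier (QHom Q A B)" and g: "g \<in> carrier (QHom Q A B)"
    and le: "f \<sqsubseteq>\<^bsub>QHom Q A B\<^esub> g"
  shows "\<Squnion>\<^bsub>QHom Q A B\<^esub> {f, g} = g"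
proof -
  interpret L: complete_lattice "QHom Q A B"
    using A B by (rule complete)
  show ?thesis
    using f g le by (intro L.le_antisym L.sup_least L.sup_upper) auto
qed

lemma comp_closed:
  assumes "A \<in> QOb Q" "B \<in> QOb Q" "C \<in> QOb Q"
    and "f \<in> carrier (QHom Q A B)" "g \<in> carrier (QHom Q B C)"
  shows "g \<bullet> f \<in> carrier (QHom Q A C)"
  using category.comp_in[OF category] assms by (simp add: quant_cat_def)

lemma comp_mono_right:
  assumes A: "A \<in> QOb Q" and B: "B \<in> QOb Q" and C: "C \<in> QOb Q"
    and f: "f \<in> carrier (QHom Q A B)" "f' \<in> carrier (QHom Q A B)" and g: "g \<in> carrier (QHom Q B C)"
    and le: "f \<sqsubseteq>\<^bsub>QHom Q A B\<^esub> f'"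
  shows "g \<bullet> f \<sqsubseteq>\<^bsub>QHom Q A C\<^esub> g \<bullet> f'"
proof -
  interpret L: complete_lattice "QHom Q A C"
    using A C by (rule complete)
  have "g \<bullet> f' = \<Squnion>\<^bsub>QHom Q A C\<^esub> {g \<bullet> f, g \<bullet> f'}"
    using comp_Sup[OF A B C g, of "{f, f'}"] sup_pair[OF A B f le] f by simp
  then show ?thesis
    using L.sup_upper[of "{g \<bullet> f, g \<bullet> f'}" "g \<bullet> f"] comp_closed[OF A B C] f g by simp
qed

lemma comp_mono_left:
  assumes A: "A \<in> QOb Q" and B: "B \<in> QOb Q" and C: "C \<in> QOb Q"
    and f: "f \<in> carrier (QHom Q A B)" and g: "g \<in> carrier (QHom Q B C)" "g' \<in> carrier (QHom Q B C)"
    and le: "g \<sqsubseteq>\<^bsub>QHom Q B C\<^esub> g'"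
  shows "g \<bullet> f \<sqsubseteq>\<^bsub>QHom Q A C\<^esub> g' \<bullet> f"
proof -
  interpret L: complete_lattice "QHom Q A C"
    using A C by (rule complete)
  have "g' \<bullet> f = \<Squnion>\<^bsub>QHom Q A C\<^esub> {g \<bullet> f, g' \<bullet> f}"
    using Sup_comp[OF A B C f, of "{g, g'}"] sup_pair[OF B C g le] g by simp
  then show ?thesis
    using L.sup_upper[of "{g \<bullet> f, g' \<bullet> f}" "g \<bullet> f"] comp_closed[OF A B C] f g by simp
qed

end

context qcategory
begin

text \<open>An inequality \<open>1 \<le> C(x, y)\<close> acts as a map
  \<open>x \<rightarrow> y\<close> over an identity, and this is precomposition with it: \<open>C(y,
  z) = C(y, z) \<circ> 1 \<le> C(y, z) \<circ> C(x, y) \<le> C(x, z)\<close>. The next lemma is the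
  postcomposition version.\<close>

lemma comp_le_of_unit_right:
  assumes x: "x \<in> EOb C" and y: "y \<in> EOb C" and z: "z \<in> EOb C" and xy: "ext C x = ext C y"
    and le: "QIdt Q (ext C x) \<sqsubseteq>\<^bsub>QHom Q (ext C x) (ext C x)\<^esub> EHom C x y"
  shows "EHom C y z \<sqsubseteq>\<^bsub>QHom Q (ext C x) (ext C z)\<^esub> EHom C x z"
proof -
  interpret Qc: category "quant_cat Q" by (fact category)
  interpret L: complete_lattice "QHom Q (ext C x) (ext C z)"
    using ext_in[OF x] ext_in[OF z] by (rule complete)
  have idt: "QIdt Q (ext C x) \<in> carrier (QHom Q (ext C x) (ext C x))"
    using Qc.idt_in ext_in[OF x] by (simp add: quant_cat_def)
  have yz: "EHom C y z \<in> carrier (QHom Q (ext C x) (ext C z))"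
    using ehom_in[OF y z] by (simp add: xy)
  have xy': "EHom C x y \<in> carrier (QHom Q (ext C x) (ext C x))"
    using ehom_in[OF x y] by (simp add: xy)
  have "EHom C y z = EHom C y z \<bullet> QIdt Q (ext C x)"
    using Qc.comp_idt[of "ext C x" "ext C z"] yz ext_in x z by (simp add: quant_cat_def)
  also have "\<dots> \<sqsubseteq>\<^bsub>QHom Q (ext C x) (ext C z)\<^esub> EHom C y z \<bullet> EHom C x y"
    using ext_in[OF x] ext_in[OF x] ext_in[OF z] idt xy' yz le by (rule comp_mono_right)
  finally show ?thesis
    using L.le_trans comp_le[OF x y z] yz comp_closed[OF _ _ _ xy' yz] ext_in[OF x] ext_in[OF z]
      ehom_in[OF x z] by blast
qed

lemma comp_le_of_unit_left:
  assumes x: "x \<in> EOb C" and y: "y \<in> EOb C" and z: "z \<in> EOb C" and yz: "ext C y = ext C z"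
    and le: "QIdt Q (ext C z) \<sqsubseteq>\<^bsub>QHom Q (ext C z) (ext C z)\<^esub> EHom C y z"
  shows "EHom C x y \<sqsubseteq>\<^bsub>QHom Q (ext C x) (ext C z)\<^esub> EHom C x z"
proof -
  interpret Qc: category "quant_cat Q" by (fact category)
  interpret L: complete_lattice "QHom Q (ext C x) (ext C z)"
    using ext_in[OF x] ext_in[OF z] by (rule complete)
  have idt: "QIdt Q (ext C z) \<in> carrier (QHom Q (ext C z) (ext C z))"
    using Qc.idt_in ext_in[OF z] by (simp add: quant_cat_def)
  have xy: "EHom C x y \<in> carrier (QHom Q (ext C x) (ext C z))"
    using ehom_in[OF x y] by (simp add: yz)
  have yz': "EHom C y z \<in> carrier (QHom Q (ext C z) (ext C z))"
    using ehom_in[OF y z] by (simp add: yz)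
  have "EHom C x y = QIdt Q (ext C z) \<bullet> EHom C x y"
    using Qc.idt_comp[of "ext C x" "ext C z"] xy ext_in x z by (simp add: quant_cat_def)
  also have "\<dots> \<sqsubseteq>\<^bsub>QHom Q (ext C x) (ext C z)\<^esub> EHom C y z \<bullet> EHom C x y"
    using ext_in[OF x] ext_in[OF z] ext_in[OF z] xy idt yz' le by (rule comp_mono_left)
  finally show ?thesis
    using L.le_trans comp_le[OF x y z] xy comp_closed[OF _ _ _ xy yz'] ext_in[OF x] ext_in[OF z]
      ehom_in[OF x z] by blast
qed

end

text \<open>The enriched counterpart of \<open>has_left_adjoint_over_iff\<close>. Unit and counit
  give the two inequalities between the homs; conversely, homs that agree yield unit, counit and
  functoriality of any choice of representing objects.\<close>

lemma has_left_qadjoint_iff: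
  assumes C: "qcategory Q C" and D: "qcategory Q D" and G: "qfunctor Q C D G"
  shows "has_left_qadjoint Q C D G \<longleftrightarrow>
    (\<forall>d\<in>EOb D. \<exists>c'\<in>EOb C. ext C c' = ext D d \<and> (\<forall>c\<in>EOb C. EHom C c' c = EHom D d (G c)))"
    (is "?adj \<longleftrightarrow> (\<forall>d\<in>EOb D. \<exists>c'\<in>EOb C. ?repr d c')")
proof -
  interpret C: qcategory Q C by fact
  interpret D: qcategory Q D by fact
  have G_in: "G c \<in> EOb D" and G_ext: "ext D (G c) = ext C c" if "c \<in> EOb C" for c
    using G that by (auto simp: qfunctor_def)
  have G_le: "EHom C c c' \<sqsubseteq>\<^bsub>QHom Q (ext C c) (ext C c')\<^esub> EHom D (G c) (G c')"
    if "c \<in> EOb C" "c' \<in> EOb C" for c c'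
    using G that by (auto simp: qfunctor_def)
  show ?thesis
  proof
    assume ?adj
    then obtain F where F: "qfunctor Q D C F" and unit: "qtrans Q D D id (G \<circ> F)"
      and counit: "qtrans Q C C (F \<circ> G) id"
      by (auto simp: has_left_qadjoint_def)
    have F_in: "F d \<in> EOb C" and F_ext: "ext C (F d) = ext D d" if "d \<in> EOb D" for d
      using F that by (auto simp: qfunctor_def)
    have "EHom C (F d) c = EHom D d (G c)" if d: "d \<in> EOb D" and c: "c \<in> EOb C" for d c
    proof -
      interpret L: complete_lattice "QHom Q (ext D d) (ext C c)"
        using D.ext_in[OF d] C.ext_in[OF c] by (rule C.complete)
      note Fd = F_in[OF d] F_ext[OF d] and Gc = G_in[OF c] G_ext[OF c]
      note GFd = G_in[OF Fd(1)] G_ext[OF Fd(1)] and FGc = F_in[OF Gc(1)] F_ext[OF Gc(1)]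
      have in_L: "EHom C (F d) c \<in> carrier (QHom Q (ext D d) (ext C c))"
        "EHom D d (G c) \<in> carrier (QHom Q (ext D d) (ext C c))"
        "EHom D (G (F d)) (G c) \<in> carrier (QHom Q (ext D d) (ext C c))"
        "EHom C (F d) (F (G c)) \<in> carrier (QHom Q (ext D d) (ext C c))"
        using C.ehom_in[OF Fd(1) c] D.ehom_in[OF d Gc(1)] D.ehom_in[OF GFd(1) Gc(1)]
          C.ehom_in[OF Fd(1) FGc(1)] Fd Gc GFd FGc
        by simp_all
      \<comment> \<open>One inequality is
        \<open>C(F d, c) \<le> D(G (F d), G c) \<le> D(d, G c)\<close>, by \<open>G\<close> and then
        the unit; the other is \<open>D(d, G c) \<le> C(F d, F (G c)) \<le> C(F d, c)\<close>, by
        \<open>F\<close> and then the counit.\<close>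
      have "EHom D (G (F d)) (G c) \<sqsubseteq>\<^bsub>QHom Q (ext D d) (ext C c)\<^esub> EHom D d (G c)"
        using D.comp_le_of_unit_right[OF d GFd(1) Gc(1)] unit d by (simp add: qtrans_def Fd Gc GFd)
      then have 1: "EHom C (F d) c \<sqsubseteq>\<^bsub>QHom Q (ext D d) (ext C c)\<^esub> EHom D d (G c)"
        using G_le[OF Fd(1) c] L.le_trans in_L by (metis Fd(2))
      have "EHom C (F d) (F (G c)) \<sqsubseteq>\<^bsub>QHom Q (ext D d) (ext C c)\<^esub> EHom C (F d) c"
        using C.comp_le_of_unit_left[OF Fd(1) FGc(1) c] counit c by (simp add: qtrans_def Fd Gc FGc)
      moreover have "EHom D d (G c) \<sqsubseteq>\<^bsub>QHom Q (ext D d) (ext C c)\<^esub> EHom C (F d) (F (G c))"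
        using F d Gc unfolding qfunctor_def by metis
      ultimately have "EHom D d (G c) \<sqsubseteq>\<^bsub>QHom Q (ext D d) (ext C c)\<^esub> EHom C (F d) c"
        using L.le_trans in_L by metis
      with 1 show ?thesis
        using L.le_antisym in_L by metis
    qed
    then show "\<forall>d\<in>EOb D. \<exists>c'\<in>EOb C. ?repr d c'"
      using F_in F_ext by blast
  next
    assume "\<forall>d\<in>EOb D. \<exists>c'\<in>EOb C. ?repr d c'"
    then obtain F where F: "\<And>d. d \<in> EOb D \<Longrightarrow> F d \<in> EOb C \<and> ?repr d (F d)"
      by metis
    \<comment> \<open>Representation at \<open>c = F d\<close> turns
      \<open>1 \<le> C(F d, F d)\<close> into the unit; at \<open>d = G c\<close> it turns
      \<open>1 \<le> D(G c, G c)\<close> into the counit.\<close>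
    have unit: "qtrans Q D D id (G \<circ> F)"
      using F C.unit_le by (fastforce simp: qtrans_def)
    have "qtrans Q C C (F \<circ> G) id"
      using F D.unit_le G_in G_ext by (fastforce simp: qtrans_def)
    moreover have "qfunctor Q D C F"
      unfolding qfunctor_def
    proof (intro conjI ballI)
      fix d d'
      assume d: "d \<in> EOb D" and d': "d' \<in> EOb D"
      \<comment> \<open>Postcomposition with the unit at \<open>d'\<close> lands in
        \<open>D(d, G (F d'))\<close>, which is \<open>C(F d, F d')\<close> by
        representation.\<close>
      show "EHom D d d' \<sqsubseteq>\<^bsub>QHom Q (ext D d) (ext D d')\<^esub> EHom C (F d) (F d')"
        using D.comp_le_of_unit_left[OF d d', of "G (F d')"] unit F d d' G_in G_ext
        by (simp add: qtrans_def)
    qed (use F in auto)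
    ultimately show ?adj
      using G unit by (auto simp: has_left_qadjoint_def)
  qed
qed


section \<open>Presheaves over the free quantaloid\<close>

lemma free_quantaloid_sel [simp]:
  "QOb (free_quantaloid B) = Ob B"
  "carrier (QHom (free_quantaloid B) X Y) = Pow (Hom B X Y)"
  "U \<sqsubseteq>\<^bsub>QHom (free_quantaloid B) X Y\<^esub> V \<longleftrightarrow> U \<subseteq> V"
  "QIdt (free_quantaloid B) X = {Idt B X}"
  "V \<bullet>\<^bsub>free_quantaloid B\<^esub> U = {v \<cdot>\<^bsub>B\<^esub> u |v u. v \<in> V \<and> u \<in> U}"
  by (simp_all add: free_quantaloid_def)

lemma qcat_of_functor_sel [simp]:
  "EOb (qcat_of_functor E p) = Ob E"
  "ext (qcat_of_functor E p) = fob p"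
  "EHom (qcat_of_functor E p) x y = far p x y ` Hom E x y"
  by (simp_all add: qcat_of_functor_def)

lemma presheaf_qcat_sel [simp]:
  "(A, \<phi>) \<in> EOb (presheaf_qcat Q C) \<longleftrightarrow> presheaf Q C A \<phi>"
  "ext (presheaf_qcat Q C) = fst"
  by (simp_all add: presheaf_qcat_def)

text \<open>A set \<open>V\<close> composes with \<open>U\<close> into \<open>W\<close> exactly when
  each of its elements does, so the largest such \<open>V\<close> collects these elements.
  Uniqueness follows by testing the adjunction property on both candidates.\<close>

lemma q_res_free_quantaloid:
  "q_res (free_quantaloid B) X Y Z U W = {v \<in> Hom B Y Z. \<forall>u\<in>U. v \<cdot>\<^bsub>B\<^esub> u \<in> W}"
  unfolding q_res_def
proof (rule the_equality, goal_cases)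
  case 1
  show ?case by auto
next
  case (2 R)
  then have R: "R \<subseteq> Hom B Y Z" and *: "\<And>V. V \<subseteq> Hom B Y Z \<Longrightarrow>
      {v \<cdot>\<^bsub>B\<^esub> u |v u. v \<in> V \<and> u \<in> U} \<subseteq> W \<longleftrightarrow> V \<subseteq> R"
    by auto
  from *[OF R] have "R \<subseteq> {v \<in> Hom B Y Z. \<forall>u\<in>U. v \<cdot>\<^bsub>B\<^esub> u \<in> W}"
    using R by blast
  moreover have "{v \<in> Hom B Y Z. \<forall>u\<in>U. v \<cdot>\<^bsub>B\<^esub> u \<in> W} \<subseteq> R"
    by (subst *[symmetric]) auto
  ultimately show ?case by blast
qed

text \<open>Membership in the hom-set is kept as a separate condition so that the empty meet is the
  top element \<open>Hom B X Y\<close>.\<close>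

lemma free_quantaloid_inf:
  assumes "S \<subseteq> Pow (Hom B X Y)"
  shows "\<Sqinter>\<^bsub>QHom (free_quantaloid B) X Y\<^esub> S = {f \<in> Hom B X Y. \<forall>U\<in>S. f \<in> U}"
  unfolding inf_def
proof (rule some_equality)
  show *: "greatest (QHom (free_quantaloid B) X Y) {f \<in> Hom B X Y. \<forall>U\<in>S. f \<in> U}
      (Lower (QHom (free_quantaloid B) X Y) S)"
    using assms by (auto simp: greatest_def Lower_def) blast
  fix U
  assume "greatest (QHom (free_quantaloid B) X Y) U (Lower (QHom (free_quantaloid B) X Y) S)"
  with * show "U = {f \<in> Hom B X Y. \<forall>U\<in>S. f \<in> U}"
    by (simp add: greatest_def subset_antisym)
qed

context
  fixes E :: "('oe, 'me) cat" and B :: "('ob, 'mb) cat" and p :: "('oe, 'me, 'ob, 'mb) func"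
  assumes p: "cat_functor E B p"
begin

interpretation p: cat_functor E B p by (fact p)

abbreviation "PE \<equiv> presheaf_qcat (free_quantaloid B) (qcat_of_functor E p)"

text \<open>The action inequality of a presheaf is closure of a sieve under precomposition. Only the
  values off \<open>Ob E\<close> differ: \<open>undefined\<close> for presheaves, empty for sieves,
  hence the conditional.\<close>

lemma presheaf_free_quantaloid_iff:
  "presheaf (free_quantaloid B) (qcat_of_functor E p) z \<phi> \<longleftrightarrow>
    z \<in> Ob B \<and> \<phi> \<in> extensional (Ob E) \<and> p_sieve E B p z (\<lambda>x. if x \<in> Ob E then \<phi> x else {})"
  by (auto simp: presheaf_def p_sieve_def) blast+

lemma EHom_presheaf_free_quantaloid:
  "EHom PE (z, \<phi>) (w, \<psi>) = {\<theta> \<in> Hom B z w. \<forall>x\<in>Ob E. \<forall>f\<in>\<phi> x. \<theta> \<cdot>\<^bsub>B\<^esub> f \<in> \<psi> x}"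
  unfolding presheaf_qcat_def
  by (simp add: q_res_free_quantaloid, subst free_quantaloid_inf) auto

text \<open>Supplies the codomain for \<open>has_left_qadjoint_iff\<close>. The homs are those of
  the category of sieves, so the two inequalities say that they contain identities and are closed
  under composition.\<close>

lemma qcategory_presheaf_free_quantaloid: "qcategory (free_quantaloid B) PE"
proof -
  interpret Q: quantaloid "free_quantaloid B"
    using p.D.category_axioms by (rule quantaloid_free_quantaloid)
  have sieve: "z \<in> Ob B" "\<And>x f. \<lbrakk>x \<in> Ob E; f \<in> \<phi> x\<rbrakk> \<Longrightarrow> f \<in> Hom B (fob p x) z"
    if "(z, \<phi>) \<in> EOb PE" for z \<phi>
    using that by (auto simp: presheaf_free_quantaloid_iff p_sieve_def split: if_splits)
  show ?thesis
  proof (unfold_locales, goal_cases)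
    case (1 x)
    then show ?case
      by (cases x) (auto simp: presheaf_free_quantaloid_iff)
  next
    case (2 x y)
    show ?case
      by (cases x; cases y) (auto simp: EHom_presheaf_free_quantaloid)
  next
    case (3 x)
    obtain z \<phi> where x: "x = (z, \<phi>)" by (cases x)
    show ?case
      using sieve[OF 3[unfolded x]] p.D.idt_comp[OF p.fob_in]
      by (auto simp: x EHom_presheaf_free_quantaloid p.D.idt_in)
  next
    case (4 x y z)
    obtain a \<phi> b \<psi> c \<chi> where xyz: "x = (a, \<phi>)" "y = (b, \<psi>)" "z = (c, \<chi>)"
      by (cases x, cases y, cases z)
    note \<phi> = sieve[OF 4(1)[unfolded xyz]] and \<psi> = sieve[OF 4(2)[unfolded xyz]]
      and \<chi> = sieve[OF 4(3)[unfolded xyz]]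
    have "v \<cdot>\<^bsub>B\<^esub> u \<in> EHom PE x z" if v: "v \<in> EHom PE y z" and u: "u \<in> EHom PE x y" for u v
    proof -
      have "(v \<cdot>\<^bsub>B\<^esub> u) \<cdot>\<^bsub>B\<^esub> f = v \<cdot>\<^bsub>B\<^esub> (u \<cdot>\<^bsub>B\<^esub> f)" if "e \<in> Ob E" "f \<in> \<phi> e" for e f
        using p.D.comp_assoc[OF p.fob_in \<phi>(1) \<psi>(1) \<chi>(1) \<phi>(2)] that u v
        by (simp add: xyz EHom_presheaf_free_quantaloid)
      then show ?thesis
        using u v p.D.comp_in[OF \<phi>(1) \<psi>(1) \<chi>(1)] by (simp add: xyz EHom_presheaf_free_quantaloid)
    qed
    then show ?case
      by (auto simp: xyz)
  qed
qed

lemma EHom_qyoneda_iff: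
  assumes "e \<in> Ob E"
  shows "\<theta> \<in> EHom PE (z, \<phi>) (qyoneda (qcat_of_functor E p) e) \<longleftrightarrow>
    lifts (sieve_cat E B p) sieve_proj \<theta> (z, \<lambda>x. if x \<in> Ob E then \<phi> x else {})
      (fob (sieve_yoneda E p) e)"
  unfolding lifts_sieve_proj_iff[OF p] using assms
  by (auto simp: qyoneda_def EHom_presheaf_free_quantaloid lifts_def image_iff)

lemma qfunctor_qyoneda:
  "qfunctor (free_quantaloid B) (qcat_of_functor E p) PE (qyoneda (qcat_of_functor E p))"
proof -
  have far_comp: "far p y z g \<cdot>\<^bsub>B\<^esub> far p x y f \<in> far p x z ` Hom E x z"
    if "x \<in> Ob E" "y \<in> Ob E" "z \<in> Ob E" "f \<in> Hom E x y" "g \<in> Hom E y z" for x y z f g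
    using that by (simp add: p.C.comp_in flip: p.far_comp)
  have "presheaf (free_quantaloid B) (qcat_of_functor E p) (fob p e)
      (\<lambda>x\<in>Ob E. far p x e ` Hom E x e)" if e: "e \<in> Ob E" for e
    unfolding presheaf_def
  proof (intro conjI ballI, goal_cases)
    case (4 x y)
    then show ?case
      using far_comp[OF _ _ e] by auto
  qed (use e in \<open>auto simp: p.fob_in p.far_in\<close>)
  then have ob: "qyoneda (qcat_of_functor E p) e \<in> EOb PE" if "e \<in> Ob E" for e
    using that by (simp add: qyoneda_def)
  have "far p x y f \<in> EHom PE (qyoneda (qcat_of_functor E p) x) (qyoneda (qcat_of_functor E p) y)"
    if x: "x \<in> Ob E" and y: "y \<in> Ob E" and f: "f \<in> Hom E x y" for x y f
    using far_comp[OF _ x y _ f] p.far_in[OF x y f]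
    by (simp add: qyoneda_def EHom_presheaf_free_quantaloid x y)
  then show ?thesis
    unfolding qfunctor_def using ob by (auto simp: qyoneda_def)
qed

text \<open>By \<open>has_left_qadjoint_iff\<close>, totality asks for an object over
  \<open>z\<close> whose hom to each \<open>e\<close> equals the hom from the presheaf to the Yoneda
  image of \<open>e\<close>. Elementwise, by \<open>EHom_qyoneda_iff\<close>, this is the final
  lifting condition of \<open>final_lifting_sieve_iff\<close>.\<close>

lemma admits_sieve_liftings_iff_qtotal:
  "admits_sieve_liftings E B p \<longleftrightarrow> qtotal (free_quantaloid B) (qcat_of_functor E p)"
proof -
  define ex_lift where "ex_lift z \<phi> \<longleftrightarrow> (\<exists>z'\<in>Ob E. fob p z' = z \<and> (\<forall>e\<in>Ob E. \<forall>\<theta>\<in>Hom B z (fob p e).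
      lifts E p \<theta> z' e \<longleftrightarrow>
        lifts (sieve_cat E B p) sieve_proj \<theta> (z, \<phi>) (fob (sieve_yoneda E p) e)))" for z \<phi>
  have repr: "(\<exists>c'\<in>Ob E. fob p c' = z \<and> (\<forall>c\<in>Ob E. far p c' c ` Hom E c' c =
      EHom PE (z, \<phi>) (qyoneda (qcat_of_functor E p) c))) \<longleftrightarrow>
      ex_lift z (\<lambda>x. if x \<in> Ob E then \<phi> x else {})" if "z \<in> Ob B" for z \<phi>
  proof -
    have "far p c' c ` Hom E c' c = EHom PE (z, \<phi>) (qyoneda (qcat_of_functor E p) c) \<longleftrightarrow>
      (\<forall>\<theta>\<in>Hom B z (fob p c). lifts E p \<theta> c' c \<longleftrightarrow>
        lifts (sieve_cat E B p) sieve_proj \<theta> (z, \<lambda>x. if x \<in> Ob E then \<phi> x else {})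
          (fob (sieve_yoneda E p) c))"
      if "c' \<in> Ob E" "c \<in> Ob E" "fob p c' = z" for c c'
    proof -
      have "\<theta> \<in> far p c' c ` Hom E c' c \<longleftrightarrow> lifts E p \<theta> c' c" for \<theta>
        by (auto simp: lifts_def)
      \<comment> \<open>Both sets consist of maps \<open>z \<rightarrow> fob p c\<close>, so their
        equality need only be tested on that hom-set.\<close>
      moreover have "\<theta> \<in> Hom B z (fob p c)" if "lifts E p \<theta> c' c" for \<theta>
        using that \<open>c' \<in> Ob E\<close> \<open>c \<in> Ob E\<close> \<open>fob p c' = z\<close> by (auto simp: lifts_def p.far_in)
      moreover have "\<theta> \<in> Hom B z (fob p c)"
        if "lifts (sieve_cat E B p) sieve_proj \<theta> (z, \<lambda>x. if x \<in> Ob E then \<phi> x else {})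
          (fob (sieve_yoneda E p) c)" for \<theta>
        using that by (simp add: lifts_sieve_proj_iff[OF p])
      ultimately show ?thesis
        unfolding set_eq_iff EHom_qyoneda_iff[OF \<open>c \<in> Ob E\<close>] by blast
    qed
    then show ?thesis
      unfolding ex_lift_def by (intro bex_cong conj_cong ball_cong) auto
  qed
  have "qtotal (free_quantaloid B) (qcat_of_functor E p) \<longleftrightarrow>
      (\<forall>(z, \<phi>)\<in>EOb PE. ex_lift z (\<lambda>x. if x \<in> Ob E then \<phi> x else {}))"
    unfolding qtotal_def has_left_qadjoint_iff[OF qcategory_qcat_of_functor[OF p.C.category_axioms
      p.D.category_axioms p] qcategory_presheaf_free_quantaloid qfunctor_qyoneda]
  proof (intro ball_cong refl, goal_cases)
    case (1 d)
    obtain z \<phi> where d: "d = (z, \<phi>)" by (cases d)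
    then have "z \<in> Ob B"
      using 1 by (simp add: presheaf_free_quantaloid_iff)
    from repr[OF this, of \<phi>] show ?case
      by (simp add: d)
  qed
  also have "\<dots> \<longleftrightarrow> (\<forall>z\<in>Ob B. \<forall>\<phi>. p_sieve E B p z \<phi> \<longrightarrow> ex_lift z \<phi>)" (is "?presheaves \<longleftrightarrow> ?sieves")
  proof
    assume presheaves: ?presheaves
    show ?sieves
    proof (intro ballI allI impI)
      fix z \<phi>
      assume z: "z \<in> Ob B" and \<phi>: "p_sieve E B p z \<phi>"
      \<comment> \<open>Passing to a presheaf makes the values off \<open>Ob E\<close>
        \<open>undefined\<close>; refilling them with the empty set returns the original
        sieve.\<close>
      have eq: "(\<lambda>x. if x \<in> Ob E then restrict \<phi> (Ob E) x else {}) = \<phi>"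
        using \<phi> by (simp add: p_sieve_def fun_eq_iff)
      then have "(z, restrict \<phi> (Ob E)) \<in> EOb PE"
        using z \<phi> by (simp only: presheaf_qcat_sel presheaf_free_quantaloid_iff restrict_extensional simp_thms)
      with presheaves have "ex_lift z (\<lambda>x. if x \<in> Ob E then restrict \<phi> (Ob E) x else {})"
        by fast
      then show "ex_lift z \<phi>"
        by (simp only: eq)
    qed
  next
    assume ?sieves
    then show ?presheaves
      by (auto simp: presheaf_free_quantaloid_iff)
  qed
  also have "\<dots> \<longleftrightarrow> admits_sieve_liftings E B p"
    by (auto simp: admits_sieve_liftings_def final_lifting_sieve_iff[OF p] ex_lift_def Bex_def)
  finally show ?thesis by simp
qed

end

theorem theorem5p2:
  fixes E :: "('oe, 'me) cat" and B :: "('ob, 'mb) cat" and p :: "('oe, 'me, 'ob, 'mb) func"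
  assumes "category E" and "category B" and "cat_functor E B p" and "faithful E p"
  shows "(topological E B p \<longleftrightarrow> admits_sieve_liftings E B p) \<and>
    (admits_sieve_liftings E B p \<longleftrightarrow>
       has_left_adjoint_over B E p (sieve_cat E B p) sieve_proj (sieve_yoneda E p)) \<and>
    (has_left_adjoint_over B E p (sieve_cat E B p) sieve_proj (sieve_yoneda E p) \<longleftrightarrow>
       qtotal (free_quantaloid B) (qcat_of_functor E p))"
  using topological_iff_admits_sieve_liftings admits_sieve_liftings_iff_left_adjoint
    admits_sieve_liftings_iff_qtotal assms by metis

end
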